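(* There exists a computable countable ordered group with order type $\mathbb{Z}^{\omega_1^{\mathrm{CK}}}\mathbb{Q}$.
   Context: An ordered group is a group $G$ with a linear order $\leq$ such that $a\leq b$ implies $ag\leq bg$ and $ga\leq gb$ for all $g\in G$. It is computable if it is presented on a computable subset of $\mathbb{N}$ with computable group operation and computable order relation. A linear order $X$ is the order type of $G$ if there is an order-preserving bijection $G\to X$. For linear orders $X,Y$, the product $XY$ is $X\times Y$ with $\langle x_0,y_0\rangle<\langle x_1,y_1\rangle$ iff $y_0<y_1$, or $y_0=y_1$ and $x_0<x_1$. For a linear order $X$, $\mathbb{Z}^X$ is the set of finitely supported functions $X\to\mathbb{Z}$, where for $f\neq g$, $f<g$ iff $f(x)<g(x)$ at the maximum $x$ where $f,g$ differ. $\mathbb{Z},\mathbb{Q}$ carry their usual orders. $\omega_1^{\mathrm{CK}}$ is the least non-computable ordinal. *)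

theory Defs
  imports "HOL-Algebra.Group" Complex_Main
begin

section \<open>Computability on the natural numbers\<close>

text \<open>Partial recursive functions, as programs with a big-step semantics:
  \<open>computes p xs y\<close> means that program \<open>p\<close> halts on input \<open>xs\<close> with output \<open>y\<close>.
  Arities are not part of the syntax; a program may be run on inputs of any length and
  diverges where no rule applies.\<close>

datatype program =
    Zero
  | Succ
  | Proj nat
  | Comp program "program list"
  | PRec program program
  | Mu program

inductive computes :: "program \<Rightarrow> nat list \<Rightarrow> nat \<Rightarrow> bool" where
  Zero: "computes Zero xs 0"
| Succ: "computes Succ [x] (Suc x)"
| Proj: "i < length xs \<Longrightarrow> computes (Proj i) xs (xs ! i)"
| Comp: "\<lbrakk>length ys = length gs; \<forall>i < length gs. computes (gs ! i) xs (ys ! i);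
          computes f ys z\<rbrakk> \<Longrightarrow> computes (Comp f gs) xs z"
| PRec_0: "computes f xs y \<Longrightarrow> computes (PRec f g) (0 # xs) y"
| PRec_Suc: "\<lbrakk>computes (PRec f g) (n # xs) y; computes g (n # y # xs) z\<rbrakk>
          \<Longrightarrow> computes (PRec f g) (Suc n # xs) z"
| Mu: "\<lbrakk>computes f (n # xs) 0; \<forall>m < n. \<exists>y. computes f (m # xs) (Suc y)\<rbrakk>
          \<Longrightarrow> computes (Mu f) xs n"

lemma computes_deterministic:
  "computes p xs y \<Longrightarrow> computes p xs z \<Longrightarrow> y = z"
proof (induction arbitrary: z rule: computes.induct)
  case (Comp ys gs xs f y)
  from Comp.prems show ?case
  proof cases
    case (Comp ys')
    then have "ys' = ys"
      using Comp.IH Comp.hyps by (auto intro!: nth_equalityI)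
    then show ?thesis using Comp Comp.IH by blast
  qed
next
  case (PRec_Suc f g n xs y w)
  from PRec_Suc.prems show ?case
    by cases (use PRec_Suc.IH in blast)
next
  case (Mu f n xs)
  from Mu.prems show ?case
  proof cases
    case Mu': Mu
    show ?thesis
    proof (rule linorder_cases[of n z])
      assume "n < z"
      then show ?thesis using Mu' Mu.IH(1) by (metis nat.distinct(1))
    next
      assume "z < n"
      then show ?thesis using Mu' Mu.IH(2) by (metis nat.distinct(1))
    qed
  qed
next
  case (PRec_0 f xs y g)
  from PRec_0.prems show ?case
    by cases (use PRec_0.IH in blast)
qed (erule computes.cases; simp)+

definition computable_set :: "nat set \<Rightarrow> bool" where
  "computable_set A \<longleftrightarrow> (\<exists>p. \<forall>x. computes p [x] (if x \<in> A then 1 else 0))"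

definition computable_rel :: "nat rel \<Rightarrow> bool" where
  "computable_rel r \<longleftrightarrow> (\<exists>p. \<forall>x y. computes p [x, y] (if (x, y) \<in> r then 1 else 0))"

text \<open>The values of \<open>f\<close> outside \<open>A\<close> are irrelevant, as for the multiplication of a
  structure with carrier \<open>A\<close>.\<close>

definition computable_binop_on :: "nat set \<Rightarrow> (nat \<Rightarrow> nat \<Rightarrow> nat) \<Rightarrow> bool" where
  "computable_binop_on A f \<longleftrightarrow> (\<exists>p. \<forall>x\<in>A. \<forall>y\<in>A. computes p [x, y] (f x y))"


section \<open>Ordered groups\<close>

locale ordered_group = group G for G (structure) +
  fixes leq :: "'a rel"
  assumes linear_order: "linear_order_on (carrier G) leq"
    and mult_right_mono:
      "\<lbrakk>(a, b) \<in> leq; g \<in> carrier G\<rbrakk> \<Longrightarrow> (a \<otimes> g, b \<otimes> g) \<in> leq"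
    and mult_left_mono:
      "\<lbrakk>(a, b) \<in> leq; g \<in> carrier G\<rbrakk> \<Longrightarrow> (g \<otimes> a, g \<otimes> b) \<in> leq"

definition computable_ordered_group :: "nat monoid \<Rightarrow> nat rel \<Rightarrow> bool" where
  "computable_ordered_group G leq \<longleftrightarrow>
     ordered_group G leq \<and>
     computable_set (carrier G) \<and>
     computable_binop_on (carrier G) (\<lambda>x y. x \<otimes>\<^bsub>G\<^esub> y) \<and>
     computable_rel leq"


section \<open>Order types\<close>

text \<open>Linear orders are reflexive relations \<open>r\<close> with underlying set \<open>Field r\<close>.\<close>

definition same_order_type :: "'a rel \<Rightarrow> 'b rel \<Rightarrow> bool" where
  "same_order_type r s \<longleftrightarrow>
     (\<exists>f. bij_betw f (Field r) (Field s) \<and>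
          (\<forall>a\<in>Field r. \<forall>b\<in>Field r. (a, b) \<in> r \<longleftrightarrow> (f a, f b) \<in> s))"

definition order_prod :: "'a rel \<Rightarrow> 'b rel \<Rightarrow> ('a \<times> 'b) rel" where
  "order_prod X Y =
     {((x0, y0), (x1, y1)). x0 \<in> Field X \<and> x1 \<in> Field X \<and> y0 \<in> Field Y \<and> y1 \<in> Field Y \<and>
        ((y0, y1) \<in> Y \<and> y0 \<noteq> y1 \<or> y0 = y1 \<and> (x0, x1) \<in> X)}"

text \<open>Finitely supported functions on \<open>Field X\<close> are represented by their extension by zero.\<close>

definition fin_supp :: "'a rel \<Rightarrow> ('a \<Rightarrow> int) set" where
  "fin_supp X = {f. finite {x. f x \<noteq> 0} \<and> {x. f x \<noteq> 0} \<subseteq> Field X}"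

definition Z_pow :: "'a rel \<Rightarrow> ('a \<Rightarrow> int) rel" where
  "Z_pow X =
     {(f, g). f \<in> fin_supp X \<and> g \<in> fin_supp X \<and>
        (f = g \<or>
         (\<exists>x\<in>Field X. f x < g x \<and> (\<forall>y\<in>Field X. f y \<noteq> g y \<longrightarrow> (y, x) \<in> X)))}"

lemma Field_Z_pow: "Field (Z_pow X) = fin_supp X"
  unfolding Z_pow_def Field_def by auto

lemma Field_order_prod:
  assumes "refl_on (Field X) X"
  shows "Field (order_prod X Y) = Field X \<times> Field Y"
  using assms unfolding order_prod_def Field_def refl_on_def by fastforce

definition rat_order :: "rat rel" where
  "rat_order = {(p, q). p \<le> q}"


section \<open>The least non-computable ordinal\<close>

definition computable_ordinal :: "nat rel \<Rightarrow> bool" where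
  "computable_ordinal r \<longleftrightarrow> (\<exists>s :: nat rel. Well_order s \<and> computable_rel s \<and> (r, s) \<in> ordIso)"

text \<open>Well-orders on subsets of \<open>\<nat>\<close> represent exactly the countable ordinals, and uncountable
  ordinals exceed all of them, so it is enough to compare with well-orders of type \<open>nat rel\<close>.\<close>

definition is_omega1_CK :: "nat rel \<Rightarrow> bool" where
  "is_omega1_CK W \<longleftrightarrow>
     Well_order W \<and> \<not> computable_ordinal W \<and>
     (\<forall>s :: nat rel. Well_order s \<and> \<not> computable_ordinal s \<longrightarrow> (W, s) \<in> ordLeq)"

lemma is_omega1_CK_unique: "is_omega1_CK W \<Longrightarrow> is_omega1_CK W' \<Longrightarrow> (W, W') \<in> ordIso"
  unfolding is_omega1_CK_def by (simp add: ordIso_iff_ordLeq)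

end

theory Submission
  imports Defs "HOL-Library.Nat_Bijection" "HOL-Library.Countable_Set"
begin

text \<open>Take a computable linear order \<open>L\<close> that is not well-founded and whose well-founded part
  \<open>W\<close> has no computable copy. Since proper initial segments of \<open>W\<close> are computable, \<open>W\<close> has type
  \<open>\<omega>\<^sub>1\<close>-Church-Kleene. The complement \<open>B\<close> of \<open>W\<close> in \<open>L\<close> has no least element, so \<open>Z_pow B\<close> is a
  countable dense order without end points, hence isomorphic to the rationals, and \<open>Z_pow L\<close>
  is the product of \<open>Z_pow W\<close> with it. Finitely supported functions with pointwise addition give
  the computable group.

  \<open>L\<close> is the Kleene-Brouwer order of a computable tree whose branches attest that every
  computable relation has a rank function into \<open>L\<close> extended by a top element. Nodes of the
  tree speak only about smaller nodes, so the tree may refer to \<open>L\<close> itself. If \<open>L\<close> were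
  well-founded, the true rank functions would form a branch, and a branch is a descending sequence
  in \<open>L\<close>; so \<open>L\<close> is not well-founded, and therefore the tree does have a branch. As \<open>L\<close> is not
  well-founded, this branch forces all computable well-founded relations to have their ranks
  in \<open>W\<close>.\<close>

section \<open>A calculus of computable functions\<close>

text \<open>Whatever a branch attests must be refutable by finite initial segments, and this fixes
  the form of every clause. Halting is undecidable, so the tree speaks of total functions
  \<open>F e\<close> that obey the defining equations of programs, and a search without success may
  take any value. That a rank is a least bound is a forall-exists statement, so a branch also
  carries a Skolem function for it. Ranks have to make sense without ordinals, since the order in
  which they are taken may be ill-founded; the top element serves points that have no bound.
  Everything below the rank of an accessible point is accessible. Were that rank the top, all nodes
  would be accessible and the order well-founded. So mere failure of well-foundedness bounds all
  computable well-orders, without any appeal to the complexity of the set of well-founded relations.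
  The self-reference is harmless because the code of a sequence is at least its length: the clauses
  checked at a node inspect only smaller numbers, and membership is computed by course-of-values
  recursion.\<close>

definition computable_fun :: "nat \<Rightarrow> (nat list \<Rightarrow> nat) \<Rightarrow> bool" where
  "computable_fun k f \<longleftrightarrow> (\<exists>p. \<forall>xs. length xs = k \<longrightarrow> computes p xs (f xs))"

definition computable1 :: "(nat \<Rightarrow> nat) \<Rightarrow> bool" where
  "computable1 f \<longleftrightarrow> computable_fun 1 (\<lambda>xs. f (xs ! 0))"

definition computable2 :: "(nat \<Rightarrow> nat \<Rightarrow> nat) \<Rightarrow> bool" where
  "computable2 f \<longleftrightarrow> computable_fun 2 (\<lambda>xs. f (xs ! 0) (xs ! 1))"

definition computable3 :: "(nat \<Rightarrow> nat \<Rightarrow> nat \<Rightarrow> nat) \<Rightarrow> bool" where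
  "computable3 f \<longleftrightarrow> computable_fun 3 (\<lambda>xs. f (xs ! 0) (xs ! 1) (xs ! 2))"

lemma computable1_iff: "computable1 f \<longleftrightarrow> (\<exists>p. \<forall>x. computes p [x] (f x))"
proof -
  have "(\<forall>xs. length xs = 1 \<longrightarrow> computes p xs (f (xs ! 0))) \<longleftrightarrow> (\<forall>x. computes p [x] (f x))" for p
    by (auto simp: length_Suc_conv)
  then show ?thesis unfolding computable1_def computable_fun_def by simp
qed

lemma computable2_iff: "computable2 f \<longleftrightarrow> (\<exists>p. \<forall>x y. computes p [x, y] (f x y))"
proof -
  have "(\<forall>xs. length xs = 2 \<longrightarrow> computes p xs (f (xs ! 0) (xs ! 1))) \<longleftrightarrow>
      (\<forall>x y. computes p [x, y] (f x y))" for p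
  proof (intro iffI allI)
    fix x y assume "\<forall>xs. length xs = 2 \<longrightarrow> computes p xs (f (xs ! 0) (xs ! 1))"
    from this[rule_format, of "[x, y]"] show "computes p [x, y] (f x y)" by simp
  qed (auto simp: length_Suc_conv numeral_2_eq_2)
  then show ?thesis unfolding computable2_def computable_fun_def by simp
qed

lemma computable3_iff: "computable3 f \<longleftrightarrow> (\<exists>p. \<forall>x y z. computes p [x, y, z] (f x y z))"
proof -
  have "(\<forall>xs. length xs = 3 \<longrightarrow> computes p xs (f (xs ! 0) (xs ! 1) (xs ! 2))) \<longleftrightarrow>
      (\<forall>x y z. computes p [x, y, z] (f x y z))" for p
  proof (intro iffI allI)
    fix x y z assume "\<forall>xs. length xs = 3 \<longrightarrow> computes p xs (f (xs ! 0) (xs ! 1) (xs ! 2))"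
    from this[rule_format, of "[x, y, z]"] show "computes p [x, y, z] (f x y z)" by simp
  qed (auto simp: length_Suc_conv numeral_2_eq_2 numeral_3_eq_3)
  then show ?thesis unfolding computable3_def computable_fun_def by simp
qed

lemma computes_Comp1:
  "computes g xs y \<Longrightarrow> computes f [y] z \<Longrightarrow> computes (Comp f [g]) xs z"
  by (rule computes.Comp[of "[y]"]) auto

lemma computes_Comp2:
  "computes g xs y \<Longrightarrow> computes g' xs y' \<Longrightarrow> computes f [y, y'] z \<Longrightarrow> computes (Comp f [g, g']) xs z"
  by (rule computes.Comp[of "[y, y']"]) (auto simp: less_Suc_eq)

lemma computable_fun_zero: "computable_fun k (\<lambda>xs. 0)"
  unfolding computable_fun_def using computes.Zero by blast

lemma computable_fun_proj: "i < k \<Longrightarrow> computable_fun k (\<lambda>xs. xs ! i)"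
  unfolding computable_fun_def using computes.Proj by blast

lemma computable_fun_comp1:
  "computable1 h \<Longrightarrow> computable_fun k f \<Longrightarrow> computable_fun k (\<lambda>xs. h (f xs))"
  unfolding computable_fun_def computable1_iff by (blast intro: computes_Comp1)

lemma computable_fun_comp2:
  "computable2 h \<Longrightarrow> computable_fun k f \<Longrightarrow> computable_fun k g \<Longrightarrow>
    computable_fun k (\<lambda>xs. h (f xs) (g xs))"
  unfolding computable_fun_def computable2_iff by (blast intro: computes_Comp2)

lemma computable1_Suc: "computable1 Suc"
  unfolding computable1_iff using computes.Succ by blast

lemma computable2_rec:
  assumes "computable1 a" "computable3 g"
  shows "computable2 (\<lambda>n x. rec_nat (a x) (\<lambda>m y. g m y x) n)"
proof -
  obtain p q where p: "\<And>x. computes p [x] (a x)" and q: "\<And>x y z. computes q [x, y, z] (g x y z)"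
    using assms unfolding computable1_iff computable3_iff by blast
  have "computes (PRec p q) [n, x] (rec_nat (a x) (\<lambda>m y. g m y x) n)" for n x
    by (induction n) (auto intro: computes.intros p q)
  then show ?thesis unfolding computable2_iff by blast
qed

lemmas computable_fun_base =
  computable_fun_zero computable_fun_proj computable_fun_comp1[OF computable1_Suc]

lemma computable1_rec:
  assumes "computable3 (\<lambda>m y x. g m y)"
  shows "computable1 (\<lambda>n. rec_nat 0 g n)"
proof -
  have "computable2 (\<lambda>n x. rec_nat 0 g n)"
    by (rule computable2_rec[OF _ assms, of "\<lambda>_. 0"]) (simp add: computable1_def computable_fun_zero)
  from computable_fun_comp2[OF this computable_fun_proj[of 0 1] computable_fun_zero]
  show ?thesis by (simp add: computable1_def)
qed

lemma computable2_add: "computable2 (+)"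
proof -
  have "computable2 (\<lambda>n x. rec_nat x (\<lambda>m y. Suc y) n)"
    by (rule computable2_rec) (auto simp: computable1_def computable3_def intro!: computable_fun_base)
  moreover have "rec_nat x (\<lambda>m y. Suc y) n = n + x" for n x :: nat
    by (induction n) auto
  ultimately show ?thesis by simp
qed

lemma computable1_pred: "computable1 (\<lambda>n. n - 1)"
proof -
  have "computable1 (\<lambda>n. rec_nat 0 (\<lambda>m y. m) n)"
    by (rule computable1_rec) (auto simp: computable3_def intro!: computable_fun_base)
  moreover have "rec_nat 0 (\<lambda>m y. m) n = n - 1" for n :: nat
    by (cases n) auto
  ultimately show ?thesis by simp
qed

lemma computable2_minus: "computable2 (-)"
proof -
  have "computable2 (\<lambda>n x. rec_nat x (\<lambda>m y. y - 1) n)"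
    by (rule computable2_rec)
      (auto simp: computable1_def computable3_def simp del: One_nat_def
        intro!: computable_fun_base computable_fun_comp1[OF computable1_pred])
  moreover have "rec_nat x (\<lambda>m y. y - 1) n = x - n" for n x :: nat
    by (induction n) auto
  ultimately have "computable2 (\<lambda>n x. x - n)" by simp
  from computable_fun_comp2[OF this computable_fun_proj[of 1 2] computable_fun_proj[of 0 2]]
  show ?thesis by (simp add: computable2_def)
qed

lemma computable1_triangle: "computable1 triangle"
proof -
  have "computable1 (\<lambda>n. rec_nat 0 (\<lambda>m y. y + Suc m) n)"
    by (rule computable1_rec)
      (auto simp: computable3_def simp del: add_Suc_right
        intro!: computable_fun_base computable_fun_comp2[OF computable2_add])
  moreover have "rec_nat 0 (\<lambda>m y. y + Suc m) n = triangle n" for n :: nat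
    by (induction n) auto
  ultimately show ?thesis by (metis (lifting) ext)
qed

section \<open>The Cantor pairing function and its projections\<close>

definition pair :: "nat \<Rightarrow> nat \<Rightarrow> nat" where "pair x y = prod_encode (x, y)"
definition pfst :: "nat \<Rightarrow> nat" where "pfst z = fst (prod_decode z)"
definition psnd :: "nat \<Rightarrow> nat" where "psnd z = snd (prod_decode z)"

lemma pfst_pair [simp]: "pfst (pair x y) = x"
  and psnd_pair [simp]: "psnd (pair x y) = y"
  and pair_pfst_psnd [simp]: "pair (pfst z) (psnd z) = z"
  and pair_eq_iff [simp]: "pair x y = pair x' y' \<longleftrightarrow> x = x' \<and> y = y'"
  by (simp_all add: pair_def pfst_def psnd_def)

lemma pair_le: "x \<le> pair x y" "y \<le> pair x y"
  by (simp_all add: pair_def le_prod_encode_1 le_prod_encode_2)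

lemma pfst_le: "pfst z \<le> z" and psnd_le: "psnd z \<le> z"
  using pair_le(1)[of "pfst z" "psnd z"] pair_le(2)[of "psnd z" "pfst z"] by simp_all

lemma triangle_ge: "n \<le> triangle n"
  by (induction n) auto

lemma pair_triangle: "pair x y = triangle (x + y) + x"
  by (simp add: pair_def prod_encode_def)

lemma psnd_less: "0 < pfst z \<Longrightarrow> psnd z < z"
  using triangle_ge[of "pfst z + psnd z"] pair_triangle[of "pfst z" "psnd z"] by simp

lemma pfst_less: "0 < z \<Longrightarrow> pfst z < z"
  using triangle_ge[of "pfst z + psnd z"] pair_triangle[of "pfst z" "psnd z"]
  by (cases "pfst z + psnd z") auto

lemma pair_0_0: "pair 0 0 = 0"
  by (simp add: pair_def prod_encode_def)

lemma pfst_0 [simp]: "pfst 0 = 0" and psnd_0 [simp]: "psnd 0 = 0"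
  using pfst_pair[of 0 0] psnd_pair[of 0 0] by (simp_all add: pair_0_0)

lemma computable2_pair: "computable2 pair"
  unfolding computable2_def pair_def prod_encode_def case_prod_conv
  by (intro computable_fun_base computable_fun_comp2[OF computable2_add]
      computable_fun_comp1[OF computable1_triangle]) auto

text \<open>Triangular root: the largest \<open>r\<close> with \<open>triangle r \<le> n\<close>.
  The truncated differences add 1 exactly when \<open>triangle (Suc y) \<le> Suc m\<close>. It makes
  the projections of \<open>pair\<close> arithmetical and so computable.\<close>

definition troot :: "nat \<Rightarrow> nat" where
  "troot = rec_nat 0 (\<lambda>m y. y + (1 - (triangle (Suc y) - Suc m)))"

lemma troot_bounds: "triangle (troot n) \<le> n \<and> n < triangle (Suc (troot n))"
proof (induction n)
  case (Suc n)
  show ?case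
  proof (cases "triangle (Suc (troot n)) \<le> Suc n")
    case True
    then have "troot (Suc n) = Suc (troot n)" by (simp add: troot_def)
    then show ?thesis using True Suc by auto
  next
    case False
    then have "troot (Suc n) = troot n" by (simp add: troot_def)
    then show ?thesis using False Suc by auto
  qed
qed (simp add: troot_def)

lemma mono_triangle: "m \<le> n \<Longrightarrow> triangle m \<le> triangle n"
  by (rule lift_Suc_mono_le) auto

lemma troot_prod_encode: "troot (prod_encode (a, b)) = a + b"
proof -
  let ?n = "prod_encode (a, b)"
  have *: "?n = triangle (a + b) + a" by (simp add: prod_encode_def)
  have "\<not> Suc (troot ?n) \<le> a + b" "\<not> Suc (a + b) \<le> troot ?n"
    using troot_bounds[of ?n] * mono_triangle[of "Suc (troot ?n)" "a + b"]
      mono_triangle[of "Suc (a + b)" "troot ?n"] by auto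
  then show ?thesis by linarith
qed

lemma computable1_troot: "computable1 troot"
proof -
  have "computable_fun 3 (\<lambda>xs. Suc 0)" by (intro computable_fun_base)
  then show ?thesis
    unfolding troot_def
    by (intro computable1_rec)
      (auto simp: computable3_def simp del: triangle_Suc
        intro!: computable_fun_base computable_fun_comp2[OF computable2_add]
        computable_fun_comp2[OF computable2_minus] computable_fun_comp1[OF computable1_triangle])
qed

lemma pfst_conv_troot: "pfst z = z - triangle (troot z)"
  and psnd_conv_troot: "psnd z = troot z - (z - triangle (troot z))"
proof -
  obtain a b where z: "z = prod_encode (a, b)" by (metis prod.collapse prod_decode_inverse)
  have *: "troot z = a + b" "z = triangle (a + b) + a"
    using troot_prod_encode z by (auto simp: prod_encode_def)
  have "pfst z = a" "psnd z = b" using z by (simp_all add: pfst_def psnd_def)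
  then show "pfst z = z - triangle (troot z)" "psnd z = troot z - (z - triangle (troot z))"
    using * by auto
qed

lemma computable1_pfst: "computable1 pfst" and computable1_psnd: "computable1 psnd"
  unfolding computable1_def pfst_conv_troot psnd_conv_troot
  by (intro computable_fun_base computable_fun_comp2[OF computable2_minus]
      computable_fun_comp1[OF computable1_triangle] computable_fun_comp1[OF computable1_troot]; simp)+

section \<open>Closure rules for unary computable functions\<close>

lemma computable_comp1: "computable1 h \<Longrightarrow> computable1 f \<Longrightarrow> computable1 (\<lambda>x. h (f x))"
  unfolding computable1_def[of f] computable1_def[of "\<lambda>x. h (f x)"] by (rule computable_fun_comp1)

lemma computable_comp2:
  "computable2 h \<Longrightarrow> computable1 f \<Longrightarrow> computable1 g \<Longrightarrow> computable1 (\<lambda>x. h (f x) (g x))"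
  unfolding computable1_def by (rule computable_fun_comp2)

lemma computable_id: "computable1 (\<lambda>x. x)"
  unfolding computable1_def by (rule computable_fun_proj) simp

lemmas computable_Suc = computable_comp1[OF computable1_Suc]

lemma computable_const: "computable1 (\<lambda>x. c)"
proof (induction c)
  case (Suc c)
  then show ?case by (rule computable_Suc)
qed (simp add: computable1_def computable_fun_zero)

lemmas computable_pair = computable_comp2[OF computable2_pair]
lemmas computable_pfst = computable_comp1[OF computable1_pfst]
lemmas computable_psnd = computable_comp1[OF computable1_psnd]
lemmas computable_add = computable_comp2[OF computable2_add]
lemmas computable_minus = computable_comp2[OF computable2_minus]

named_theorems computable_intros
declare computable_id [computable_intros] computable_const [computable_intros] computable_pair [computable_intros]
  computable_pfst [computable_intros] computable_psnd [computable_intros] computable_add [computable_intros]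
  computable_minus [computable_intros] computable_Suc [computable_intros]

text \<open>Packing arguments with \<open>pair\<close> reduces every arity to one, so that the rules
  collected in \<open>computable_intros\<close> need to treat only unary functions.\<close>

lemma computable2I: "computable1 (\<lambda>z. f (pfst z) (psnd z)) \<Longrightarrow> computable2 f"
  using computable_fun_comp1[OF _ computable_fun_comp2[OF computable2_pair, of 2 "\<lambda>xs. xs ! 0" "\<lambda>xs. xs ! 1"],
      of "\<lambda>z. f (pfst z) (psnd z)"]
  by (simp add: computable2_def computable_fun_proj)

lemma computable3I: "computable1 (\<lambda>z. f (pfst z) (pfst (psnd z)) (psnd (psnd z))) \<Longrightarrow> computable3 f"
  using computable_fun_comp1[OF _ computable_fun_comp2[OF computable2_pair, of 3 "\<lambda>xs. xs ! 0"
      "\<lambda>xs. pair (xs ! 1) (xs ! 2)"], of "\<lambda>z. f (pfst z) (pfst (psnd z)) (psnd (psnd z))"]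
    computable_fun_comp2[OF computable2_pair, of 3 "\<lambda>xs. xs ! 1" "\<lambda>xs. xs ! 2"]
  by (simp add: computable3_def computable_fun_proj)

lemma computable_rec:
  assumes "computable1 a" "computable1 (\<lambda>z. g (pfst z) (pfst (psnd z)) (psnd (psnd z)))" "computable1 n"
  shows "computable1 (\<lambda>x. rec_nat (a x) (\<lambda>m y. g m y x) (n x))"
  by (rule computable_comp2[OF computable2_rec[OF assms(1) computable3I[OF assms(2)]] assms(3) computable_id])

lemma computable_Least:
  assumes "computable1 (\<lambda>z. f (pfst z) (psnd z))" "\<And>x. \<exists>n. f n x = 0"
  shows "computable1 (\<lambda>x. LEAST n. f n x = 0)"
proof -
  obtain p where p: "\<And>x y. computes p [x, y] (f x y)"
    using computable2I[OF assms(1)] computable2_iff by blast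
  have "computes (Mu p) [x] (LEAST n. f n x = 0)" for x
  proof (rule computes.Mu)
    show "computes p [LEAST n. f n x = 0, x] 0"
      using p[of "LEAST n. f n x = 0" x] LeastI_ex[OF assms(2)] by simp
    show "\<forall>m<LEAST n. f n x = 0. \<exists>y. computes p [m, x] (Suc y)"
    proof safe
      fix m assume "m < (LEAST n. f n x = 0)"
      then have "f m x \<noteq> 0" by (rule not_less_Least)
      then show "\<exists>y. computes p [m, x] (Suc y)" using p[of m x] by (metis not0_implies_Suc)
    qed
  qed
  then show ?thesis unfolding computable1_iff by blast
qed

section \<open>Decidable predicates and bounded quantifiers\<close>

definition decidable :: "(nat \<Rightarrow> bool) \<Rightarrow> bool" where
  "decidable P \<longleftrightarrow> computable1 (\<lambda>x. if P x then 1 else 0)"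

lemma decidable_zero: "computable1 f \<Longrightarrow> decidable (\<lambda>x. f x = 0)"
proof -
  assume "computable1 f"
  then have "computable1 (\<lambda>x. 1 - f x)" by (intro computable_intros)
  moreover have "(\<lambda>x. 1 - f x) = (\<lambda>x. if f x = 0 then 1 else 0)" by auto
  ultimately show ?thesis by (simp add: decidable_def)
qed

lemma decidable_if_zero:
  assumes "decidable P" shows "computable1 (\<lambda>x. if P x then 0 else 1)"
proof -
  have "computable1 (\<lambda>x. 1 - (if P x then 1 else 0))"
    using assms unfolding decidable_def by (intro computable_intros)
  moreover have "(\<lambda>x. 1 - (if P x then 1 else 0 :: nat)) = (\<lambda>x. if P x then 0 else 1)" by auto
  ultimately show ?thesis by simp
qed

lemma decidable_not: "decidable P \<Longrightarrow> decidable (\<lambda>x. \<not> P x)"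
proof -
  assume "decidable P"
  moreover have "(\<lambda>x. if \<not> P x then 1 else 0 :: nat) = (\<lambda>x. if P x then 0 else 1)" by auto
  ultimately show ?thesis using decidable_if_zero by (simp add: decidable_def)
qed

lemma decidable_conj: "decidable P \<Longrightarrow> decidable Q \<Longrightarrow> decidable (\<lambda>x. P x \<and> Q x)"
proof -
  assume "decidable P" "decidable Q"
  then have "decidable (\<lambda>x. (if P x then 0 else 1) + (if Q x then 0 else 1) = (0::nat))"
    by (intro decidable_zero computable_intros decidable_if_zero)
  moreover have "((if P x then 0 else 1) + (if Q x then 0 else 1) = (0::nat)) \<longleftrightarrow> P x \<and> Q x" for x
    by auto
  ultimately show ?thesis by simp
qed

lemma decidable_disj: "decidable P \<Longrightarrow> decidable Q \<Longrightarrow> decidable (\<lambda>x. P x \<or> Q x)"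
  using decidable_not[OF decidable_conj[OF decidable_not decidable_not]] by simp

lemma decidable_imp: "decidable P \<Longrightarrow> decidable Q \<Longrightarrow> decidable (\<lambda>x. P x \<longrightarrow> Q x)"
  unfolding imp_conv_disj by (intro decidable_disj decidable_not)

lemma decidable_le: "computable1 f \<Longrightarrow> computable1 g \<Longrightarrow> decidable (\<lambda>x. f x \<le> g x)"
  using decidable_zero[OF computable_minus] by simp

lemma decidable_less: "computable1 f \<Longrightarrow> computable1 g \<Longrightarrow> decidable (\<lambda>x. f x < g x)"
  using decidable_not[OF decidable_le] by (simp add: not_le)

lemma decidable_eq: "computable1 f \<Longrightarrow> computable1 g \<Longrightarrow> decidable (\<lambda>x. f x = g x)"
  using decidable_conj[OF decidable_le decidable_le] by (simp add: eq_iff)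

lemma computable_if:
  assumes "decidable P" "computable1 f" "computable1 g"
  shows "computable1 (\<lambda>x. if P x then f x else g x)"
proof -
  \<comment> \<open>A case distinction is a recursion of length 1 or 0.\<close>
  have "computable1 (\<lambda>x. rec_nat (g x) (\<lambda>m y. f x) (if P x then 1 else 0))"
    using assms(1) unfolding decidable_def
    by (intro computable_rec computable_intros computable_comp1[OF assms(2)] assms(3))
  moreover have "(\<lambda>x. rec_nat (g x) (\<lambda>m y. f x) (if P x then 1 else 0)) = (\<lambda>x. if P x then f x else g x)"
    by auto
  ultimately show ?thesis by simp
qed

lemma decidable_comp: "decidable P \<Longrightarrow> computable1 f \<Longrightarrow> decidable (\<lambda>x. P (f x))"
  unfolding decidable_def by (rule computable_comp1)

lemma decidable_ex:
  assumes "decidable (\<lambda>z. P (pfst z) (psnd z))" "computable1 b"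
  shows "decidable (\<lambda>x. \<exists>k<b x. P k x)"
proof -
  have "decidable (\<lambda>z. pfst (psnd z) = 1 \<or> P (pfst z) (psnd (psnd z)))"
  proof (intro decidable_disj decidable_eq computable_intros)
    have "computable1 (\<lambda>z. pair (pfst z) (psnd (psnd z)))" by (intro computable_intros)
    from decidable_comp[OF assms(1) this] show "decidable (\<lambda>z. P (pfst z) (psnd (psnd z)))" by simp
  qed
  then have "computable1 (\<lambda>x. rec_nat 0 (\<lambda>m y. if y = 1 \<or> P m x then 1 else 0) (b x))"
    by (intro computable_rec assms(2) computable_intros computable_if)
  moreover have "rec_nat 0 (\<lambda>m y. if y = 1 \<or> P m x then 1 else 0) n = (if \<exists>k<n. P k x then 1 else 0 :: nat)"
    for n x by (induction n) (auto simp: less_Suc_eq)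
  ultimately show ?thesis by (simp add: decidable_def)
qed

lemma decidable_all:
  assumes "decidable (\<lambda>z. P (pfst z) (psnd z))" "computable1 b"
  shows "decidable (\<lambda>x. \<forall>k<b x. P k x)"
  using decidable_not[OF decidable_ex[of "\<lambda>k x. \<not> P k x"]] decidable_not[OF assms(1)] assms(2) by simp

declare decidable_not [computable_intros] decidable_conj [computable_intros] decidable_disj [computable_intros]
  decidable_imp [computable_intros] decidable_le [computable_intros] decidable_less [computable_intros]
  decidable_eq [computable_intros] computable_if [computable_intros] decidable_ex [computable_intros] decidable_all [computable_intros]

lemma computable_setI: "decidable (\<lambda>x. x \<in> A) \<Longrightarrow> computable_set A"
  unfolding computable_set_def decidable_def computable1_iff .

lemma computable_relI: "decidable (\<lambda>z. (pfst z, psnd z) \<in> r) \<Longrightarrow> computable_rel r"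
  unfolding computable_rel_def decidable_def
  by (drule computable2I[of "\<lambda>x y. if (x, y) \<in> r then 1 else 0"]) (simp add: computable2_iff)

lemma computable_rel_iff: "computable_rel r \<longleftrightarrow> computable2 (\<lambda>x y. if (x, y) \<in> r then 1 else 0)"
  unfolding computable_rel_def computable2_iff ..

lemma decidable_rel:
  "computable_rel r \<Longrightarrow> computable1 f \<Longrightarrow> computable1 g \<Longrightarrow> decidable (\<lambda>x. (f x, g x) \<in> r)"
  unfolding computable_rel_iff decidable_def by (drule computable_comp2)

section \<open>Codes of finite sequences and the Kleene-Brouwer order\<close>

text \<open>\<open>list_encode\<close> sends \<open>x # xs\<close> to the successor of a pair, so
  \<open>psnd (y - 1)\<close> codes the tail. The code 0 of the empty list is fixed by this step, so
  dropping may run past the end.\<close>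

definition drop_code :: "nat \<Rightarrow> nat \<Rightarrow> nat" where
  "drop_code k c = rec_nat c (\<lambda>m y. psnd (y - 1)) k"

definition nth_code :: "nat \<Rightarrow> nat \<Rightarrow> nat" where
  "nth_code c k = pfst (drop_code k c - 1)"

definition len_code :: "nat \<Rightarrow> nat" where
  "len_code c = length (list_decode c)"

lemma drop_code: "drop_code k c = list_encode (drop k (list_decode c))"
proof (induction k)
  case (Suc k)
  show ?case
  proof (cases "drop k (list_decode c)")
    case Nil
    then show ?thesis using Suc by (simp add: drop_code_def)
  next
    case (Cons x xs)
    then have "drop (Suc k) (list_decode c) = xs" by (metis drop_Suc list.sel(3) tl_drop)
    then show ?thesis using Suc Cons by (simp add: drop_code_def psnd_def)
  qed
qed (simp add: drop_code_def)

lemma less_len_code_iff: "k < len_code c \<longleftrightarrow> drop_code k c \<noteq> 0"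
proof -
  have "drop_code k c = 0 \<longleftrightarrow> drop k (list_decode c) = []"
    unfolding drop_code by (metis list_encode.simps(1) list_encode_eq)
  then show ?thesis by (simp add: len_code_def not_le)
qed

lemma nth_code: "k < len_code c \<Longrightarrow> nth_code c k = list_decode c ! k"
  by (cases "drop k (list_decode c)")
    (simp_all add: nth_code_def drop_code len_code_def pfst_def nth_via_drop)

lemma len_code_Least: "len_code c = (LEAST k. drop_code k c = 0)"
  by (rule Least_equality[symmetric]) (use less_len_code_iff in \<open>auto simp: not_less[symmetric]\<close>)

lemma length_le_list_encode: "length xs \<le> list_encode xs"
  by (induction xs) (auto intro: order_trans[OF _ le_prod_encode_2])

lemma len_code_le: "len_code c \<le> c"
  unfolding len_code_def using length_le_list_encode[of "list_decode c"] by simp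

lemma computable_drop_code:
  "computable1 f \<Longrightarrow> computable1 g \<Longrightarrow> computable1 (\<lambda>x. drop_code (f x) (g x))"
  unfolding drop_code_def by (intro computable_rec computable_intros)

lemma computable_nth_code:
  "computable1 f \<Longrightarrow> computable1 g \<Longrightarrow> computable1 (\<lambda>x. nth_code (f x) (g x))"
  unfolding nth_code_def by (intro computable_drop_code computable_intros)

lemma computable_len_code: "computable1 f \<Longrightarrow> computable1 (\<lambda>x. len_code (f x))"
proof (rule computable_comp1[of len_code])
  have "computable1 (\<lambda>c. LEAST k. drop_code k c = 0)"
    by (intro computable_Least computable_drop_code computable_intros)
      (metis less_len_code_iff less_irrefl)
  then show "computable1 len_code" by (simp add: len_code_Least[abs_def])
qed

declare computable_nth_code [computable_intros] computable_len_code [computable_intros]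

text \<open>Extensions lie below their prefixes; this is why the initial segments of a branch
  descend.\<close>

fun kb :: "nat list \<Rightarrow> nat list \<Rightarrow> bool" where
  "kb xs [] \<longleftrightarrow> True"
| "kb [] (y # ys) \<longleftrightarrow> False"
| "kb (x # xs) (y # ys) \<longleftrightarrow> x < y \<or> x = y \<and> kb xs ys"

lemma kb_refl: "kb xs xs"
  by (induction xs) auto

lemma kb_trans: "kb xs ys \<Longrightarrow> kb ys zs \<Longrightarrow> kb xs zs"
proof (induction xs ys arbitrary: zs rule: kb.induct)
  case (1 xs)
  then show ?case by (cases zs) auto
next
  case (3 x xs y ys)
  then show ?case by (cases zs) auto
qed auto

lemma kb_antisym: "kb xs ys \<Longrightarrow> kb ys xs \<Longrightarrow> xs = ys"
  by (induction xs ys rule: kb.induct) (auto elim: kb.elims)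

lemma kb_total: "kb xs ys \<or> kb ys xs"
  by (induction xs ys rule: kb.induct) auto

lemma kb_prefix: "kb (xs @ ys) xs"
  by (induction xs) auto

text \<open>\<open>i\<close> is the position that decides the comparison, with
  \<open>i = length ys\<close> for the case that \<open>ys\<close> is a prefix of \<open>xs\<close>.
  All quantifiers are bounded, so the closure rules yield decidability of the coded order.\<close>

lemma kb_iff:
  "kb xs ys \<longleftrightarrow> (\<exists>i<Suc (length ys). i \<le> length xs \<and> (\<forall>j<i. xs ! j = ys ! j) \<and>
     (i = length ys \<or> i < length xs \<and> i < length ys \<and> xs ! i < ys ! i))"
proof (induction xs ys rule: kb.induct)
  case (3 x xs y ys)
  show ?case (is "_ \<longleftrightarrow> (\<exists>i<_. ?P i)")
  proof
    assume "kb (x # xs) (y # ys)"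
    then consider "x < y" | "x = y" "kb xs ys" by auto
    then show "\<exists>i<Suc (length (y # ys)). ?P i"
    proof cases
      case 1
      then show ?thesis by (intro exI[of _ 0]) auto
    next
      case 2
      then obtain i where "i < Suc (length ys)" "i \<le> length xs" "\<forall>j<i. xs ! j = ys ! j"
        "i = length ys \<or> i < length xs \<and> i < length ys \<and> xs ! i < ys ! i"
        using 3 by blast
      then show ?thesis using 2 by (intro exI[of _ "Suc i"]) (auto simp: nth_Cons split: nat.splits)
    qed
  next
    assume "\<exists>i<Suc (length (y # ys)). ?P i"
    then obtain i where i: "i < Suc (length (y # ys))" "?P i" by blast
    show "kb (x # xs) (y # ys)"
    proof (cases i)
      case 0
      then show ?thesis using i by auto
    next
      case (Suc k)
      then have "x = y" "\<forall>j<k. xs ! j = ys ! j" using i by force+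
      then show ?thesis using i Suc 3 by auto
    qed
  qed
qed auto

definition kb_code :: "nat \<Rightarrow> nat \<Rightarrow> bool" where
  "kb_code a b \<longleftrightarrow> kb (list_decode a) (list_decode b)"

definition kb_less :: "nat \<Rightarrow> nat \<Rightarrow> bool" where
  "kb_less a b \<longleftrightarrow> kb_code a b \<and> a \<noteq> b"

lemma kb_code_iff:
  "kb_code a b \<longleftrightarrow> (\<exists>i<Suc (len_code b). i \<le> len_code a \<and> (\<forall>j<i. nth_code a j = nth_code b j) \<and>
     (i = len_code b \<or> i < len_code a \<and> i < len_code b \<and> nth_code a i < nth_code b i))"
  unfolding kb_code_def kb_iff len_code_def[symmetric]
  by (intro ex_cong1 conj_cong refl) (auto simp: nth_code)

lemma decidable_kb_code:
  assumes "computable1 f" "computable1 g"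
  shows "decidable (\<lambda>x. kb_code (f x) (g x))"
proof -
  have "decidable (\<lambda>z. kb_code (pfst z) (psnd z))"
    unfolding kb_code_iff by (intro computable_intros)
  from decidable_comp[OF this computable_pair[OF assms]] show ?thesis by simp
qed

lemma decidable_kb_less:
  "computable1 f \<Longrightarrow> computable1 g \<Longrightarrow> decidable (\<lambda>x. kb_less (f x) (g x))"
  unfolding kb_less_def by (intro decidable_kb_code computable_intros)

lemma list_decode_eq_iff: "list_decode a = list_decode b \<longleftrightarrow> a = b"
  using inj_list_decode by (meson injD)

lemma kb_less_trans: "kb_less a b \<Longrightarrow> kb_less b c \<Longrightarrow> kb_less a c"
  unfolding kb_less_def kb_code_def by (metis kb_antisym kb_trans list_decode_eq_iff)

lemma kb_less_total: "a \<noteq> b \<Longrightarrow> kb_less a b \<or> kb_less b a"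
  unfolding kb_less_def kb_code_def using kb_total by blast

section \<open>A self-referential computable tree\<close>

text \<open>Indices of programs: the tags 0 to 4 stand for basic functions, pairing, composition,
  primitive recursion and minimisation; \<open>i\<close> and \<open>j\<close> are operands.\<close>

definition index :: "nat \<Rightarrow> nat \<Rightarrow> nat \<Rightarrow> nat" where
  "index t i j = pair t (pair i j)"

text \<open>A branch \<open>g\<close> of the tree codes functions \<open>F e x = g (posF e x)\<close>, the rank \<open>g (posH e x)\<close> of \<open>x\<close>
  in the relation \<open>{(y, x). F e (pair y (pair x 0)) = 1}\<close>, and, for \<open>b\<close> below the rank of \<open>x\<close>, a predecessor
  \<open>g (posW e x b)\<close> of \<open>x\<close> whose rank is at least \<open>b\<close>. Ranks are elements of \<open>P\<close> (the tree itself);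
  every number outside \<open>P\<close> stands for the top element. The conditions \<open>ok\<close> are Horn clauses in
  the graph of \<open>g\<close>, so that they can be evaluated on finite approximations \<open>\<Gamma>\<close>.\<close>

definition posF :: "nat \<Rightarrow> nat \<Rightarrow> nat" where "posF e x = pair 0 (pair e x)"
definition posH :: "nat \<Rightarrow> nat \<Rightarrow> nat" where "posH e x = pair 1 (pair e x)"
definition posW :: "nat \<Rightarrow> nat \<Rightarrow> nat \<Rightarrow> nat" where "posW e x b = pair 2 (pair e (pair x b))"

text \<open>Argument lists are nested pairs, so head and tail suffice to generate all
  projections.\<close>

definition basic :: "nat \<Rightarrow> nat \<Rightarrow> nat" where
  "basic j x = (if j = 0 then 0 else if j = 1 then Suc (pfst x) else if j = 2 then pfst x else psnd x)"

definition below :: "(nat \<Rightarrow> bool) \<Rightarrow> nat \<Rightarrow> nat \<Rightarrow> bool" where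
  "below P a b \<longleftrightarrow> P a \<and> (P b \<longrightarrow> kb_less a b)"

definition ok_basic :: "(nat \<Rightarrow> nat \<Rightarrow> bool) \<Rightarrow> nat \<Rightarrow> bool" where
  "ok_basic \<Gamma> N \<longleftrightarrow> (\<forall>j<N. \<forall>x<N. \<forall>w<N. \<Gamma> (posF (index 0 0 j) x) w \<longrightarrow> w = basic j x)"

definition ok_pair :: "(nat \<Rightarrow> nat \<Rightarrow> bool) \<Rightarrow> nat \<Rightarrow> bool" where
  "ok_pair \<Gamma> N \<longleftrightarrow> (\<forall>i<N. \<forall>j<N. \<forall>x<N. \<forall>u<N. \<forall>v<N. \<forall>w<N.
     \<Gamma> (posF i x) u \<and> \<Gamma> (posF j x) v \<and> \<Gamma> (posF (index 1 i j) x) w \<longrightarrow> w = pair u v)"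

definition ok_comp :: "(nat \<Rightarrow> nat \<Rightarrow> bool) \<Rightarrow> nat \<Rightarrow> bool" where
  "ok_comp \<Gamma> N \<longleftrightarrow> (\<forall>i<N. \<forall>j<N. \<forall>x<N. \<forall>u<N. \<forall>v<N. \<forall>w<N.
     \<Gamma> (posF j x) u \<and> \<Gamma> (posF i u) v \<and> \<Gamma> (posF (index 2 i j) x) w \<longrightarrow> w = v)"

definition ok_rec0 :: "(nat \<Rightarrow> nat \<Rightarrow> bool) \<Rightarrow> nat \<Rightarrow> bool" where
  "ok_rec0 \<Gamma> N \<longleftrightarrow> (\<forall>i<N. \<forall>j<N. \<forall>x<N. \<forall>u<N. \<forall>w<N.
     \<Gamma> (posF i x) u \<and> \<Gamma> (posF (index 3 i j) (pair 0 x)) w \<longrightarrow> w = u)"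

definition ok_rec_Suc :: "(nat \<Rightarrow> nat \<Rightarrow> bool) \<Rightarrow> nat \<Rightarrow> bool" where
  "ok_rec_Suc \<Gamma> N \<longleftrightarrow> (\<forall>i<N. \<forall>j<N. \<forall>n<N. \<forall>x<N. \<forall>u<N. \<forall>v<N. \<forall>w<N.
     \<Gamma> (posF (index 3 i j) (pair n x)) u \<and> \<Gamma> (posF j (pair n (pair u x))) v \<and>
     \<Gamma> (posF (index 3 i j) (pair (Suc n) x)) w \<longrightarrow> w = v)"

text \<open>If \<open>F i\<close> has no zero over \<open>x\<close>, the clause is empty and
  \<open>w\<close> is free: a finite approximation cannot tell that a search fails. Leastness comes
  from comparing \<open>w\<close> with every zero \<open>m\<close>.\<close>

definition ok_mu :: "(nat \<Rightarrow> nat \<Rightarrow> bool) \<Rightarrow> nat \<Rightarrow> bool" where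
  "ok_mu \<Gamma> N \<longleftrightarrow> (\<forall>i<N. \<forall>x<N. \<forall>m<N. \<forall>v<N. \<forall>w<N.
     \<Gamma> (posF i (pair m x)) 0 \<and> \<Gamma> (posF (index 4 i 0) x) w \<and> \<Gamma> (posF i (pair w x)) v
       \<longrightarrow> v = 0 \<and> w \<le> m)"

definition ok_incr :: "(nat \<Rightarrow> bool) \<Rightarrow> (nat \<Rightarrow> nat \<Rightarrow> bool) \<Rightarrow> nat \<Rightarrow> bool" where
  "ok_incr P \<Gamma> N \<longleftrightarrow> (\<forall>e<N. \<forall>x<N. \<forall>y<N. \<forall>u<N. \<forall>v<N.
     \<Gamma> (posF e (pair y (pair x 0))) 1 \<and> \<Gamma> (posH e y) u \<and> \<Gamma> (posH e x) v
       \<longrightarrow> \<not> P v \<or> below P u v)"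

definition ok_sup :: "(nat \<Rightarrow> bool) \<Rightarrow> (nat \<Rightarrow> nat \<Rightarrow> bool) \<Rightarrow> nat \<Rightarrow> bool" where
  "ok_sup P \<Gamma> N \<longleftrightarrow> (\<forall>e<N. \<forall>x<N. \<forall>b<N. \<forall>y<N. \<forall>r<N. \<forall>u<N. \<forall>v<N.
     \<Gamma> (posH e x) v \<and> below P b v \<and> \<Gamma> (posW e x b) y \<and>
     \<Gamma> (posF e (pair y (pair x 0))) r \<and> \<Gamma> (posH e y) u
       \<longrightarrow> r = 1 \<and> \<not> below P u b)"

definition ok :: "(nat \<Rightarrow> bool) \<Rightarrow> (nat \<Rightarrow> nat \<Rightarrow> bool) \<Rightarrow> nat \<Rightarrow> bool" where
  "ok P \<Gamma> N \<longleftrightarrow> ok_basic \<Gamma> N \<and> ok_pair \<Gamma> N \<and> ok_comp \<Gamma> N \<and> ok_rec0 \<Gamma> N \<and>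
     ok_rec_Suc \<Gamma> N \<and> ok_mu \<Gamma> N \<and> ok_incr P \<Gamma> N \<and> ok_sup P \<Gamma> N"

lemmas ok_defs = ok_basic_def ok_pair_def ok_comp_def ok_rec0_def ok_rec_Suc_def ok_mu_def
  ok_incr_def ok_sup_def

text \<open>\<open>\<Gamma>\<close> occurs only in premises of the clauses, so a smaller graph and a
  smaller bound leave fewer instances to satisfy. This closes the tree under prefixes.\<close>

lemma ok_antimono:
  assumes "ok P \<Gamma> N" "M \<le> N" "\<And>a u. \<Delta> a u \<Longrightarrow> \<Gamma> a u"
  shows "ok P \<Delta> M"
proof -
  have *: "k < M \<Longrightarrow> k < N" for k using assms(2) by simp
  show ?thesis
    using assms(1) unfolding ok_def
    by (elim conj_forward; unfold ok_defs; meson * assms(3))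
qed

lemma ok_cong:
  assumes "\<And>a. a < N \<Longrightarrow> P a \<longleftrightarrow> Q a"
  shows "ok P \<Gamma> N \<longleftrightarrow> ok Q \<Gamma> N"
proof -
  have "below P a b \<longleftrightarrow> below Q a b" if "a < N" "b < N" for a b
    using assms that by (simp add: below_def)
  then show ?thesis unfolding ok_def ok_incr_def ok_sup_def using assms
    by (simp cong: conj_cong imp_cong)
qed

definition entry :: "nat \<Rightarrow> nat \<Rightarrow> nat \<Rightarrow> bool" where
  "entry c a u \<longleftrightarrow> a < len_code c \<and> nth_code c a = u"

text \<open>The guard \<open>u < c\<close> is harmless: all elements that \<open>ok\<close> inspects are below the
  length of the sequence coded by \<open>c\<close>.\<close>

declare conj_cong [fundef_cong]

function tree :: "nat \<Rightarrow> bool" where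
  "tree c = ok (\<lambda>u. u < c \<and> tree u) (entry c) (len_code c)"
  by auto
text \<open>With \<open>conj_cong\<close> as congruence rule the recursive call comes with its guard
  \<open>u < c\<close>.\<close>

termination by (relation "measure id") auto

declare tree.simps [simp del]

lemma tree_iff: "tree c \<longleftrightarrow> ok tree (entry c) (len_code c)"
  unfolding tree.simps[of c] using len_code_le[of c] by (intro ok_cong) auto

section \<open>Decidability of the tree\<close>

definition lookup :: "nat \<Rightarrow> nat \<Rightarrow> nat" where
  "lookup t k = pfst (rec_nat t (\<lambda>m y. psnd y) k)"

lemma lookup_pair: "lookup (pair a t) k = (case k of 0 \<Rightarrow> a | Suc k \<Rightarrow> lookup t k)"
proof -
  have "rec_nat (pair a t) (\<lambda>m y. psnd y) (Suc k) = rec_nat t (\<lambda>m y. psnd y) k" for k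
    by (induction k) auto
  then show ?thesis by (auto simp: lookup_def split: nat.split)
qed

text \<open>Course-of-values recursion: \<open>t\<close> is a stack of the truth values for all
  smaller numbers, the latest on top, so the value for \<open>u\<close> lies at depth
  \<open>c - Suc u\<close>.\<close>

definition tree_step :: "nat \<Rightarrow> nat \<Rightarrow> bool" where
  "tree_step c t \<longleftrightarrow> ok (\<lambda>u. u < c \<and> lookup t (c - Suc u) = 1) (entry c) (len_code c)"

definition tree_table :: "nat \<Rightarrow> nat" where
  "tree_table = rec_nat 0 (\<lambda>c t. pair (if tree_step c t then 1 else 0) t)"

lemma tree_table: "(\<forall>u<c. lookup (tree_table c) (c - Suc u) = (if tree u then 1 else 0)) \<and>
   (tree_step c (tree_table c) \<longleftrightarrow> tree c)"
proof (induction c)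
  case 0
  have "len_code 0 = 0" using len_code_le[of 0] by simp
  then show ?case by (simp add: tree_step_def tree.simps[of 0])
next
  case (Suc c)
  then have 1: "lookup (tree_table (Suc c)) (Suc c - Suc u) = (if tree u then 1 else 0)" if "u < Suc c" for u
  proof -
    have "tree_table (Suc c) = pair (if tree_step c (tree_table c) then 1 else 0) (tree_table c)"
      by (simp add: tree_table_def)
    moreover have "Suc c - Suc u = (if u < c then Suc (c - Suc u) else 0)" using that by auto
    ultimately show ?thesis using that Suc by (auto simp: lookup_pair less_Suc_eq)
  qed
  then have "tree_step (Suc c) (tree_table (Suc c)) \<longleftrightarrow> tree (Suc c)"
    unfolding tree_step_def tree.simps[of "Suc c"] using len_code_le[of "Suc c"]
    by (intro ok_cong) auto
  with 1 show ?case by blast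
qed

lemma computable_lookup: "computable1 f \<Longrightarrow> computable1 g \<Longrightarrow> computable1 (\<lambda>x. lookup (f x) (g x))"
  unfolding lookup_def by (intro computable_rec computable_intros)

lemma decidable_tree_step:
  "decidable (\<lambda>z. tree_step (pfst z) (psnd z))"
  unfolding tree_step_def ok_def ok_defs entry_def below_def basic_def index_def posF_def posH_def posW_def
  by (intro conjI computable_lookup decidable_kb_less computable_intros)

lemma decidable_tree: "decidable tree"
proof -
  have "decidable (\<lambda>z. tree_step (pfst z) (pfst (psnd z)))"
    using decidable_comp[OF decidable_tree_step, of "\<lambda>z. pair (pfst z) (pfst (psnd z))"]
    by (simp add: computable_pair computable_id computable_pfst computable_psnd)
  then have 1: "computable1 tree_table"
    unfolding tree_table_def by (intro computable_rec computable_intros)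
  have "decidable (\<lambda>c. tree_step c (tree_table c))"
    using decidable_comp[OF decidable_tree_step computable_pair[OF computable_id 1]] by simp
  then show ?thesis using tree_table by simp
qed

section \<open>Branches of the tree\<close>

definition branch :: "(nat \<Rightarrow> nat) \<Rightarrow> bool" where
  "branch g \<longleftrightarrow> (\<forall>N. tree (list_encode (map g [0..<N])))"

lemma branch_iff: "branch g \<longleftrightarrow> (\<forall>N. ok tree (\<lambda>a u. a < N \<and> g a = u) N)"
proof -
  have "entry (list_encode (map g [0..<N])) = (\<lambda>a u. a < N \<and> g a = u)" for N
    by (intro ext) (auto simp: entry_def nth_code len_code_def)
  then have "tree (list_encode (map g [0..<N])) \<longleftrightarrow> ok tree (\<lambda>a u. a < N \<and> g a = u) N" for N
    using tree_iff[of "list_encode (map g [0..<N])"] by (simp only:) (simp add: len_code_def)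
  then show ?thesis unfolding branch_def by blast
qed

definition closed_family :: "(nat \<Rightarrow> nat \<Rightarrow> nat) \<Rightarrow> bool" where
  "closed_family F \<longleftrightarrow>
     (\<forall>j x. F (index 0 0 j) x = basic j x) \<and>
     (\<forall>i j x. F (index 1 i j) x = pair (F i x) (F j x)) \<and>
     (\<forall>i j x. F (index 2 i j) x = F i (F j x)) \<and>
     (\<forall>i j x. F (index 3 i j) (pair 0 x) = F i x) \<and>
     (\<forall>i j n x. F (index 3 i j) (pair (Suc n) x) = F j (pair n (pair (F (index 3 i j) (pair n x)) x))) \<and>
     (\<forall>i x m. F i (pair m x) = 0 \<longrightarrow> F i (pair (F (index 4 i 0) x) x) = 0 \<and> F (index 4 i 0) x \<le> m)"

text \<open>\<open>h x\<close> is meant as the least strict upper bound of the ranks of the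
  \<open>R\<close>-predecessors of \<open>x\<close>, with the top where there is none;
  \<open>w\<close> witnesses leastness. The notion stays meaningful for an ill-founded
  \<open>R\<close> and an ill-founded order.\<close>

definition ranked :: "(nat \<Rightarrow> bool) \<Rightarrow> (nat \<Rightarrow> nat \<Rightarrow> bool) \<Rightarrow> (nat \<Rightarrow> nat) \<Rightarrow> (nat \<Rightarrow> nat \<Rightarrow> nat) \<Rightarrow> bool" where
  "ranked P R h w \<longleftrightarrow>
     (\<forall>x y. R y x \<longrightarrow> \<not> P (h x) \<or> below P (h y) (h x)) \<and>
     (\<forall>x b. below P b (h x) \<longrightarrow> R (w x b) x \<and> \<not> below P (h (w x b)) b)"

text \<open>Each equation is an instance of one clause, read off at a stage exceeding all positions
  and values involved. The sums \<open>?N\<close> are merely large enough.\<close>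

lemma branch_closed_family:
  assumes "branch g"
  shows "closed_family (\<lambda>e x. g (posF e x))"
proof -
  let ?G = "\<lambda>N a u. a < N \<and> g a = u" and ?F = "\<lambda>e x. g (posF e x)"
  have ok: "ok_basic (?G N) N" "ok_pair (?G N) N" "ok_comp (?G N) N" "ok_rec0 (?G N) N"
    "ok_rec_Suc (?G N) N" "ok_mu (?G N) N" for N
    using assms unfolding branch_iff ok_def by blast+
  show ?thesis unfolding closed_family_def
  proof (intro conjI allI impI)
    fix j x
    let ?N = "Suc (j + x + posF (index 0 0 j) x + ?F (index 0 0 j) x)"
    show "?F (index 0 0 j) x = basic j x"
      using ok(1)[unfolded ok_basic_def, rule_format, of j ?N x "?F (index 0 0 j) x"] by simp
  next
    fix i j x
    let ?N = "Suc (i + j + x + posF (index 1 i j) x + ?F (index 1 i j) x + posF i x + ?F i x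
      + posF j x + ?F j x)"
    show "?F (index 1 i j) x = pair (?F i x) (?F j x)"
      using ok(2)[unfolded ok_pair_def, rule_format, of i ?N j x "?F i x" "?F j x" "?F (index 1 i j) x"]
      by simp
  next
    fix i j x
    let ?u = "?F j x"
    let ?N = "Suc (i + j + x + posF (index 2 i j) x + ?F (index 2 i j) x + posF i ?u + ?F i ?u
      + posF j x + ?F j x)"
    show "?F (index 2 i j) x = ?F i (?F j x)"
      using ok(3)[unfolded ok_comp_def, rule_format, of i ?N j x ?u "?F i ?u" "?F (index 2 i j) x"]
      by simp
  next
    fix i j x
    let ?w = "?F (index 3 i j) (pair 0 x)"
    let ?N = "Suc (i + j + x + posF (index 3 i j) (pair 0 x) + ?w + posF i x + ?F i x)"
    show "?w = ?F i x"
      using ok(4)[unfolded ok_rec0_def, rule_format, of i ?N j x "?F i x" ?w] by simp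
  next
    fix i j n x
    let ?w = "?F (index 3 i j) (pair (Suc n) x)" and ?u = "?F (index 3 i j) (pair n x)"
    let ?v = "?F j (pair n (pair ?u x))"
    let ?N = "Suc (i + j + n + x + posF (index 3 i j) (pair (Suc n) x) + ?w +
      posF (index 3 i j) (pair n x) + ?u + posF j (pair n (pair ?u x)) + ?v)"
    show "?w = ?v"
      using ok(5)[unfolded ok_rec_Suc_def, rule_format, of i ?N j n x ?u ?v ?w] by simp
  next
    fix i x m
    assume m: "?F i (pair m x) = 0"
    let ?w = "?F (index 4 i 0) x"
    let ?v = "?F i (pair ?w x)"
    let ?N = "Suc (i + x + m + posF i (pair m x) + posF (index 4 i 0) x + ?w + posF i (pair ?w x) + ?v)"
    show "?v = 0" "?w \<le> m"
      using ok(6)[unfolded ok_mu_def, rule_format, of i ?N x m ?v ?w] m by simp_all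
  qed
qed

lemma branch_ranked:
  assumes "branch g"
  shows "ranked tree (\<lambda>y x. g (posF e (pair y (pair x 0))) = 1) (\<lambda>x. g (posH e x)) (\<lambda>x b. g (posW e x b))"
proof -
  let ?G = "\<lambda>N a u. a < N \<and> g a = u" and ?F = "\<lambda>x. g (posF e x)"
  let ?h = "\<lambda>x. g (posH e x)" and ?w = "\<lambda>x b. g (posW e x b)"
  have ok: "ok_incr tree (?G N) N" "ok_sup tree (?G N) N" for N
    using assms unfolding branch_iff ok_def by blast+
  show ?thesis unfolding ranked_def
  proof (intro conjI allI impI)
    fix x y assume *: "?F (pair y (pair x 0)) = 1"
    let ?N = "Suc (e + x + y + posF e (pair y (pair x 0)) + 1 + posH e y + ?h y + posH e x + ?h x)"
    show "\<not> tree (?h x) \<or> below tree (?h y) (?h x)"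
      using ok(1)[unfolded ok_incr_def, rule_format, of e ?N x y "?h y" "?h x"] * by simp
  next
    fix x b assume *: "below tree b (?h x)"
    let ?y = "?w x b"
    let ?r = "?F (pair ?y (pair x 0))"
    let ?N = "Suc (e + x + b + posH e x + ?h x + posW e x b + ?y + posF e (pair ?y (pair x 0)) + ?r
      + posH e ?y + ?h ?y)"
    show "?r = 1" "\<not> below tree (?h ?y) b"
      using ok(2)[unfolded ok_sup_def, rule_format, of e ?N x b ?y ?r "?h ?y" "?h x"] * by simp_all
  qed
qed

lemma branch_if_ranked:
  assumes F: "closed_family F"
    and R: "\<And>e. ranked tree (\<lambda>y x. F e (pair y (pair x 0)) = 1) (h e) (w e)"
  shows "\<exists>g. branch g"
proof -
  define g where "g n = (if pfst n = 0 then F (pfst (psnd n)) (psnd (psnd n))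
    else if pfst n = 1 then h (pfst (psnd n)) (psnd (psnd n))
    else w (pfst (psnd n)) (pfst (psnd (psnd n))) (psnd (psnd (psnd n))))" for n
  have [simp]: "g (posF e x) = F e x" "g (posH e x) = h e x" "g (posW e x b) = w e x b" for e x b
    by (simp_all add: g_def posF_def posH_def posW_def)
  have "ok tree (\<lambda>a u. a < N \<and> g a = u) N" for N
    unfolding ok_def
  proof (intro conjI)
    note F' = F[unfolded closed_family_def]
    show "ok_basic (\<lambda>a u. a < N \<and> g a = u) N" using F' by (simp add: ok_basic_def)
    show "ok_pair (\<lambda>a u. a < N \<and> g a = u) N" using F' by (simp add: ok_pair_def)
    show "ok_comp (\<lambda>a u. a < N \<and> g a = u) N" using F' by (simp add: ok_comp_def)
    show "ok_rec0 (\<lambda>a u. a < N \<and> g a = u) N" using F' by (simp add: ok_rec0_def)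
    show "ok_rec_Suc (\<lambda>a u. a < N \<and> g a = u) N" using F' by (simp add: ok_rec_Suc_def)
    show "ok_mu (\<lambda>a u. a < N \<and> g a = u) N"
    proof -
      have "F i (pair m x) = 0 \<Longrightarrow> F i (pair (F (index 4 i 0) x) x) = 0 \<and> F (index 4 i 0) x \<le> m"
        for i x m using F' by blast
      then show ?thesis unfolding ok_mu_def by auto
    qed
    show "ok_incr tree (\<lambda>a u. a < N \<and> g a = u) N"
      using R unfolding ok_incr_def ranked_def by auto
    show "ok_sup tree (\<lambda>a u. a < N \<and> g a = u) N"
      using R unfolding ok_sup_def ranked_def by auto
  qed
  then show ?thesis unfolding branch_iff by blast
qed

section \<open>Universality of closed families\<close>

fun tuple :: "nat list \<Rightarrow> nat" where
  "tuple [] = 0"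
| "tuple (x # xs) = pair x (tuple xs)"

text \<open>The functions \<open>F e\<close> are total, so they agree with a program only where it halts.\<close>

lemma closed_family_universal:
  assumes F: "closed_family F"
  shows "\<exists>e. \<forall>xs y. computes p xs y \<longrightarrow> F e (tuple xs) = y"
proof -
  note F' = F[unfolded closed_family_def]
  show ?thesis
  proof (induction p)
    case Zero
    have "F (index 0 0 0) x = 0" for x using F' by (simp add: basic_def)
    then show ?case by (metis computes.Zero computes_deterministic)
  next
    case Succ
    have "F (index 0 0 1) x = Suc (pfst x)" for x using F' by (simp add: basic_def)
    then show ?case by (intro exI[of _ "index 0 0 1"]) (auto elim: computes.cases)
  next
    case (Proj i)
    have "\<exists>e. \<forall>xs. i < length xs \<longrightarrow> F e (tuple xs) = xs ! i"
    proof (induction i)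
      case 0
      have "F (index 0 0 2) x = pfst x" for x using F' by (simp add: basic_def)
      then show ?case by (intro exI[of _ "index 0 0 2"] allI) (case_tac xs, auto)
    next
      case (Suc i)
      then obtain e where e: "\<And>xs. i < length xs \<Longrightarrow> F e (tuple xs) = xs ! i" by blast
      \<comment> \<open>Composition with the tail function shifts the projection by one
        place.\<close>
      have "F (index 2 e (index 0 0 3)) x = F e (psnd x)" for x using F' by (simp add: basic_def)
      then show ?case
        by (intro exI[of _ "index 2 e (index 0 0 3)"] allI) (case_tac xs, auto simp: e)
    qed
    then obtain e where "\<And>xs. i < length xs \<Longrightarrow> F e (tuple xs) = xs ! i" by blast
    then show ?case by (intro exI[of _ e]) (auto elim: computes.cases)
  next
    case (Comp f gs)
    \<comment> \<open>The inner results are assembled into the code of one argument list: pairing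
      prepends a result, and the zero function supplies the empty list.\<close>
    have "\<exists>e. \<forall>xs ys. length ys = length gs \<and> (\<forall>i<length gs. computes (gs ! i) xs (ys ! i))
        \<longrightarrow> F e (tuple xs) = tuple ys"
      using Comp(2)
    proof (induction gs)
      case Nil
      have "F (index 0 0 0) x = 0" for x using F' by (simp add: basic_def)
      then show ?case by (intro exI[of _ "index 0 0 0"]) auto
    next
      case (Cons q gs)
      have "\<exists>e. \<forall>xs ys. length ys = length gs \<and> (\<forall>i<length gs. computes (gs ! i) xs (ys ! i))
          \<longrightarrow> F e (tuple xs) = tuple ys"
        by (rule Cons.IH) (rule Cons.prems, simp)
      then obtain e where e: "\<And>xs ys. length ys = length gs \<Longrightarrow>
          (\<forall>i<length gs. computes (gs ! i) xs (ys ! i)) \<Longrightarrow> F e (tuple xs) = tuple ys" by blast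
      obtain d where d: "\<And>xs y. computes q xs y \<Longrightarrow> F d (tuple xs) = y" using Cons(2)[of q] by auto
      have *: "F (index 1 d e) x = pair (F d x) (F e x)" for x using F' by blast
      show ?case
      proof (intro exI[of _ "index 1 d e"] allI impI, elim conjE)
        fix xs ys assume len: "length ys = length (q # gs)"
          and c: "\<forall>i<length (q # gs). computes ((q # gs) ! i) xs (ys ! i)"
        obtain y ys' where ys: "ys = y # ys'" using len by (cases ys) auto
        have "F d (tuple xs) = y" using c ys by (intro d) force
        moreover have "F e (tuple xs) = tuple ys'" using c ys len by (intro e) force+
        ultimately show "F (index 1 d e) (tuple xs) = tuple ys" unfolding * ys by simp
      qed
    qed
    then obtain e where e: "\<And>xs ys. length ys = length gs \<Longrightarrow> (\<forall>i<length gs. computes (gs ! i) xs (ys ! i))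
        \<Longrightarrow> F e (tuple xs) = tuple ys" by blast
    obtain d where d: "\<And>xs y. computes f xs y \<Longrightarrow> F d (tuple xs) = y" using Comp(1) by blast
    have *: "F (index 2 d e) x = F d (F e x)" for x using F' by blast
    show ?case
    proof (intro exI[of _ "index 2 d e"] allI impI)
      fix xs y assume "computes (program.Comp f gs) xs y"
      then show "F (index 2 d e) (tuple xs) = y"
        by cases (simp add: * e d)
    qed
  next
    case (PRec f q)
    obtain d where d: "\<And>xs y. computes f xs y \<Longrightarrow> F d (tuple xs) = y" using PRec(1) by blast
    obtain e where e: "\<And>xs y. computes q xs y \<Longrightarrow> F e (tuple xs) = y" using PRec(2) by blast
    have rec0: "F (index 3 d e) (pair 0 x) = F d x" for x using F' by blast
    have S: "F (index 3 d e) (pair (Suc n) x) = F e (pair n (pair (F (index 3 d e) (pair n x)) x))" for n x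
      using F' by blast
    have *: "computes (PRec f q) (n # xs) y \<Longrightarrow> F (index 3 d e) (pair n (tuple xs)) = y" for n xs y
    proof (induction n arbitrary: y)
      case 0
      then show ?case by cases (simp add: rec0 d)
    next
      case (Suc n)
      from Suc.prems show ?case
      proof cases
        case (PRec_Suc u)
        then have "F e (tuple (n # u # xs)) = y" by (intro e)
        then show ?thesis using Suc.IH PRec_Suc by (simp add: S)
      qed
    qed
    show ?case
    proof (intro exI[of _ "index 3 d e"] allI impI)
      fix xs y assume c: "computes (PRec f q) xs y"
      then obtain n xs' where "xs = n # xs'" by cases auto
      then show "F (index 3 d e) (tuple xs) = y" using c * by simp
    qed
  next
    case (Mu f)
    obtain d where d: "\<And>xs y. computes f xs y \<Longrightarrow> F d (tuple xs) = y" using Mu by blast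
    have *: "F d (pair (F (index 4 d 0) x) x) = 0 \<and> F (index 4 d 0) x \<le> m" if "F d (pair m x) = 0" for m x
      using F' that by blast
    show ?case
    proof (intro exI[of _ "index 4 d 0"] allI impI)
      fix xs y assume "computes (program.Mu f) xs y"
      then show "F (index 4 d 0) (tuple xs) = y"
      proof cases
        case Mu
        let ?w = "F (index 4 d 0) (tuple xs)"
        have w: "F d (pair ?w (tuple xs)) = 0" "?w \<le> y"
          using *[of y "tuple xs"] d[OF Mu(1)] unfolding tuple.simps by blast+
        have "\<not> ?w < y"
        proof
          assume "?w < y"
          then obtain v where "computes f (?w # xs) (Suc v)" using Mu(2) by blast
          from d[OF this] w(1) show False by simp
        qed
        with w(2) show ?thesis by simp
      qed
    qed
  qed
qed

text \<open>The intended evaluation of indices, which shows that closed families exist. Where a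
  search fails, \<open>LEAST\<close> takes an unspecified value, as the clause for minimisation
  permits.\<close>

function ev :: "nat \<Rightarrow> nat \<Rightarrow> nat" where
  "ev e = (let i = pfst (psnd e); j = psnd (psnd e) in
     if pfst e = 0 then basic j
     else if pfst e = 1 then (\<lambda>x. pair (ev i x) (ev j x))
     else if pfst e = 2 then (\<lambda>x. ev i (ev j x))
     else if pfst e = 3 then
       (\<lambda>x. rec_nat (ev i (psnd x)) (\<lambda>n u. ev j (pair n (pair u (psnd x)))) (pfst x))
     else (\<lambda>x. LEAST w. ev i (pair w x) = 0))"
  by auto
termination
proof -
  \<comment> \<open>Only nonzero tags make recursive calls, and a nonzero first component makes the
    second one smaller than the code.\<close>
  have "psnd (psnd e) < e" "pfst (psnd e) < e" if "pfst e \<noteq> 0" for e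
    using psnd_less[of e] pfst_le[of "psnd e"] psnd_le[of "psnd e"] that by auto
  then show ?thesis by (intro local.termination[of "measure id"]) auto
qed

declare ev.simps [simp del]

lemma ev_index:
  "ev (index t i j) =
    (if t = 0 then basic j
     else if t = 1 then (\<lambda>x. pair (ev i x) (ev j x))
     else if t = 2 then (\<lambda>x. ev i (ev j x))
     else if t = 3 then
       (\<lambda>x. rec_nat (ev i (psnd x)) (\<lambda>n u. ev j (pair n (pair u (psnd x)))) (pfst x))
     else (\<lambda>x. LEAST w. ev i (pair w x) = 0))"
  by (subst ev.simps) (simp add: index_def)

lemma closed_family_ev: "closed_family ev"
  unfolding closed_family_def by (auto simp: ev_index intro: LeastI Least_le)

section \<open>Existence of a branch\<close>

definition tree_less :: "nat rel" where
  "tree_less = {(a, b). tree a \<and> tree b \<and> kb_less a b}"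

lemma branch_not_wf:
  assumes g: "branch g"
  shows "\<not> wf tree_less"
proof -
  let ?p = "\<lambda>n. map g [0..<n]"
  have "(list_encode (?p (Suc n)), list_encode (?p n)) \<in> tree_less" for n
  proof -
    have "?p (Suc n) = ?p n @ [g n]" by simp
    then have "kb (?p (Suc n)) (?p n)" by (metis kb_prefix)
    moreover have "list_encode (?p (Suc n)) \<noteq> list_encode (?p n)" by (simp add: list_encode_eq)
    ultimately show ?thesis
      using g by (simp add: branch_def tree_less_def kb_less_def kb_code_def del: upt_Suc)
  qed
  then have "\<exists>f. \<forall>i. (f (Suc i), f i) \<in> tree_less"
    by (intro exI[of _ "\<lambda>n. list_encode (?p n)"] allI)
  then show ?thesis unfolding wf_iff_no_infinite_down_chain by simp
qed

text \<open>States that the rank of \<open>x\<close> is at most \<open>a\<close>, with nodes in the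
  role of ordinals.\<close>

inductive rank_le :: "(nat \<Rightarrow> nat \<Rightarrow> bool) \<Rightarrow> nat \<Rightarrow> nat \<Rightarrow> bool" for R where
  "(\<And>y. R y x \<Longrightarrow> \<exists>b. (b, a) \<in> tree_less \<and> rank_le R b y) \<Longrightarrow> rank_le R a x"

text \<open>Over a well-founded tree order, the rank of \<open>x\<close> is its least bound among
  the nodes, or the top if there is no bound.\<close>

lemma ranked_exists:
  assumes wf: "wf tree_less"
  shows "\<exists>h w. ranked tree R h w"
proof -
  \<comment> \<open>The top needs a representative outside the tree. If every number were a node,
    any function would be a branch.\<close>
  have "\<exists>t. \<not> tree t"
  proof (rule ccontr)
    assume "\<nexists>t. \<not> tree t"
    then have "branch (\<lambda>_. 0)" by (simp add: branch_def)
    then show False using wf branch_not_wf by blast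
  qed
  then obtain t where t: "\<not> tree t" ..
  define best where "best x a \<longleftrightarrow>
    tree a \<and> rank_le R a x \<and> (\<forall>b. (b, a) \<in> tree_less \<longrightarrow> \<not> rank_le R b x)" for x a
  define h where "h x = (if \<exists>a. best x a then SOME a. best x a else t)" for x
  have best: "best x (h x)" if "tree a" "rank_le R a x" for a x
  proof -
    have "a \<in> {a. tree a \<and> rank_le R a x}" using that by simp
    from wfE_min[OF wf this] obtain a' where "best x a'"
      unfolding best_def by (metis (no_types, lifting) mem_Collect_eq tree_less_def case_prodD)
    then show ?thesis unfolding h_def by (auto intro: someI)
  qed
  have best': "best x (h x)" if "tree (h x)" for x
    using that t unfolding h_def by (auto intro: someI split: if_splits)
  have "\<exists>y. below tree b (h x) \<longrightarrow> R y x \<and> \<not> below tree (h y) b" for x b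
  proof (cases "below tree b (h x)")
    case True
    \<comment> \<open>A node \<open>b\<close> below the least bound is not a bound, so some
      predecessor \<open>y\<close> of \<open>x\<close> has no bound below \<open>b\<close>. This
      \<open>y\<close> is the required witness.\<close>
    have "\<not> rank_le R b x"
    proof
      assume b: "rank_le R b x"
      moreover have "tree b" using True by (simp add: below_def)
      ultimately have "best x (h x)" by (intro best)
      then show False using True b by (auto simp: below_def tree_less_def best_def)
    qed
    then obtain y where y: "R y x" "\<And>c. (c, b) \<in> tree_less \<Longrightarrow> \<not> rank_le R c y"
      using rank_le.intros[of R x b] by blast
    have "\<not> below tree (h y) b"
    proof
      assume *: "below tree (h y) b"
      then have "best y (h y)" by (intro best') (simp add: below_def)
      moreover have "(h y, b) \<in> tree_less" using * True by (simp add: below_def tree_less_def)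
      ultimately show False using y(2) by (auto simp: best_def)
    qed
    then show ?thesis using y by blast
  qed blast
  then have "\<forall>x. \<exists>v. \<forall>b. below tree b (h x) \<longrightarrow> R (v b) x \<and> \<not> below tree (h (v b)) b"
    by (intro allI choice) blast
  from choice[OF this] obtain w where
    w: "\<And>x b. below tree b (h x) \<longrightarrow> R (w x b) x \<and> \<not> below tree (h (w x b)) b" by blast
  have "\<not> tree (h x) \<or> below tree (h y) (h x)" if "R y x" for x y
  proof (cases "tree (h x)")
    case True
    then have "rank_le R (h x) x" using best' by (simp add: best_def)
    then obtain b where b: "(b, h x) \<in> tree_less" "rank_le R b y"
      using \<open>R y x\<close> by (auto elim: rank_le.cases)
    then have "best y (h y)" by (intro best) (auto simp: tree_less_def)
    then have "tree (h y)" "b = h y \<or> kb_less (h y) b"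
      using b kb_less_total by (auto simp: tree_less_def best_def)
    then have "below tree (h y) (h x)"
      using b kb_less_trans by (auto simp: below_def tree_less_def)
    then show ?thesis ..
  qed simp
  with w have "ranked tree R h w" by (simp add: ranked_def)
  then show ?thesis by blast
qed

lemma kb_append_cancel: "kb (zs @ xs) (zs @ ys) \<longleftrightarrow> kb xs ys"
  by (induction zs) auto

lemma tree_prefix:
  assumes "tree (list_encode (xs @ ys))" shows "tree (list_encode xs)"
  by (rule iffD2[OF tree_iff], rule ok_antimono[OF iffD1[OF tree_iff assms]]) (auto simp: len_code_def entry_def nth_code nth_append)

text \<open>The leftmost branch that stays below a set without minimal elements.\<close>

lemma branch_if_not_wf:
  assumes "\<not> wf tree_less"
  shows "\<exists>g. branch g"
proof -
  have "\<exists>Q z. z \<in> Q \<and> (\<forall>z\<in>Q. \<exists>y. (y, z) \<in> tree_less \<and> y \<in> Q)"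
  proof (rule ccontr)
    assume neg: "\<not> ?thesis"
    have "wf tree_less"
    proof (rule wfI_min)
      fix x :: nat and Q assume "x \<in> Q"
      then have "\<not> (\<forall>z\<in>Q. \<exists>y. (y, z) \<in> tree_less \<and> y \<in> Q)" using neg by metis
      then show "\<exists>z\<in>Q. \<forall>y. (y, z) \<in> tree_less \<longrightarrow> y \<notin> Q" by metis
    qed
    with assms show False ..
  qed
  then obtain Q z where Q: "z \<in> Q" "\<And>z. z \<in> Q \<Longrightarrow> \<exists>y. (y, z) \<in> tree_less \<and> y \<in> Q"
    by blast
  define A where "A = {xs. list_encode xs \<in> Q \<and> tree (list_encode xs)}"
  have A_less: "\<exists>ys\<in>A. kb ys xs \<and> ys \<noteq> xs" if xs: "list_encode xs \<in> Q" for xs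
  proof -
    obtain y where "(y, list_encode xs) \<in> tree_less" "y \<in> Q" using Q(2)[OF xs] by blast
    then show ?thesis
      by (intro bexI[of _ "list_decode y"]) (auto simp: A_def tree_less_def kb_less_def kb_code_def)
  qed
  define next_entry where "next_entry ps = (LEAST a. \<exists>ys. ps @ a # ys \<in> A)" for ps
  define pre where "pre = rec_nat [] (\<lambda>_ ps. ps @ [next_entry ps])"
  have pre: "pre 0 = []" "pre (Suc n) = pre n @ [next_entry (pre n)]" for n
    by (simp_all add: pre_def)
  \<comment> \<open>The second half keeps the construction going when \<open>pre n\<close> itself
    lies in \<open>A\<close>: a smaller element of \<open>A\<close> must then extend it properly,
    which provides a next entry.\<close>
  have inv: "(\<exists>ys. pre n @ ys \<in> A) \<and> (\<forall>xs\<in>A. kb xs (pre n) \<longrightarrow> (\<exists>ys. xs = pre n @ ys))" for n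
  proof (induction n)
    case 0
    show ?case using A_less[of "list_decode z"] Q(1) by (auto simp: pre)
  next
    case (Suc n)
    let ?p = "pre n"
    obtain ys where ys: "?p @ ys \<in> A" using Suc by blast
    have "\<exists>a ys. ?p @ a # ys \<in> A"
    proof (cases ys)
      case Nil
      then have "list_encode ?p \<in> Q" using ys by (simp add: A_def)
      then obtain xs where "xs \<in> A" "kb xs ?p" "xs \<noteq> ?p" using A_less by blast
      then obtain ys' where "xs = ?p @ ys'" using Suc by blast
      then show ?thesis using \<open>xs \<in> A\<close> \<open>xs \<noteq> ?p\<close> by (cases ys') auto
    qed (use ys in blast)
    then have 1: "\<exists>ys. ?p @ next_entry ?p # ys \<in> A"
      unfolding next_entry_def by (rule LeastI_ex)
    have 2: "next_entry ?p \<le> a" if "?p @ a # ys \<in> A" for a ys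
      unfolding next_entry_def using that by (intro Least_le) blast
    have "\<exists>ys. xs = pre (Suc n) @ ys" if "xs \<in> A" "kb xs (pre (Suc n))" for xs
    proof -
      have "kb xs ?p" using that kb_trans kb_prefix pre by metis
      then obtain ys where ys: "xs = ?p @ ys" using Suc \<open>xs \<in> A\<close> by blast
      have "kb ys [next_entry ?p]" using that(2) by (simp add: pre ys kb_append_cancel)
      then obtain a zs where "ys = a # zs" "a \<le> next_entry ?p" by (cases ys) auto
      then show ?thesis using 2[of a zs] that(1) ys by (auto simp: pre)
    qed
    with 1 show ?case by (auto simp: pre)
  qed
  have len: "length (pre n) = n" for n by (induction n) (auto simp: pre)
  define g where "g n = next_entry (pre n)" for n
  have "map g [0..<n] = pre n" for n by (induction n) (auto simp: pre g_def)
  moreover have "tree (list_encode (pre n))" for n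
    using inv[of n] tree_prefix by (auto simp: A_def)
  ultimately have "branch g" by (simp add: branch_def)
  then show ?thesis by blast
qed

lemma branch_exists: "\<exists>g. branch g"
proof (cases "wf tree_less")
  case True
  then have "\<forall>e. \<exists>h w. ranked tree (\<lambda>y x. ev e (pair y (pair x 0)) = 1) h w"
    by (intro allI ranked_exists)
  from choice[OF this] obtain h
    where "\<forall>e. \<exists>w. ranked tree (\<lambda>y x. ev e (pair y (pair x 0)) = 1) (h e) w" by blast
  from choice[OF this] obtain w
    where "\<And>e. ranked tree (\<lambda>y x. ev e (pair y (pair x 0)) = 1) (h e) (w e)" by blast
  with closed_family_ev show ?thesis by (rule branch_if_ranked)
qed (rule branch_if_not_wf)

lemma not_wf_tree_less: "\<not> wf tree_less"
  using branch_exists branch_not_wf by blast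

section \<open>The well-founded part has no computable copy\<close>

definition tree_order :: "nat rel" where
  "tree_order = {(a, b). tree a \<and> tree b \<and> kb_code a b}"

lemma Field_tree_order: "Field tree_order = {a. tree a}"
  by (auto simp: tree_order_def Field_def kb_code_def kb_refl)

lemma tree_order_minus_Id: "tree_order - Id = tree_less"
  by (auto simp: tree_order_def tree_less_def kb_less_def)

lemma Linear_order_tree_order: "Linear_order tree_order"
proof -
  have "refl_on {a. tree a} tree_order"
    by (auto simp: refl_on_def tree_order_def kb_code_def kb_refl)
  moreover have "trans tree_order"
    by (auto simp: trans_def tree_order_def kb_code_def intro: kb_trans)
  moreover have "antisym tree_order"
    by (auto simp: antisym_def tree_order_def kb_code_def list_decode_eq_iff dest: kb_antisym)
  moreover have "total_on {a. tree a} tree_order"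
    using kb_total by (auto simp: total_on_def tree_order_def kb_code_def)
  moreover have "tree_order \<subseteq> {a. tree a} \<times> {a. tree a}"
    by (auto simp: tree_order_def)
  ultimately show ?thesis
    by (simp add: linear_order_on_def partial_order_on_def preorder_on_def Field_tree_order)
qed

lemma computable_rel_tree_order: "computable_rel tree_order"
  by (rule computable_relI)
    (auto simp: tree_order_def intro!: decidable_conj decidable_comp[OF decidable_tree] decidable_kb_code computable_intros)

text \<open>Ill-foundedness of the tree order is what keeps accessible points away from the
  top.\<close>

lemma ranked_in_acc:
  assumes ranked: "ranked tree R h w" and x: "Wellfounded.accp R x"
  shows "tree (h x) \<and> h x \<in> Wellfounded.acc tree_less"
  using x
proof (induction rule: accp.induct)
  case (accI x)
  \<comment> \<open>The witness for \<open>b\<close> is a predecessor of \<open>x\<close> whose rank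
    is at least \<open>b\<close> and, by induction, accessible.\<close>
  have *: "b \<in> Wellfounded.acc tree_less" if b: "below tree b (h x)" for b
  proof -
    have w: "R (w x b) x" "\<not> below tree (h (w x b)) b" using ranked b by (auto simp: ranked_def)
    then have h: "tree (h (w x b))" "h (w x b) \<in> Wellfounded.acc tree_less" using accI by blast+
    moreover have "tree b" using b by (simp add: below_def)
    ultimately have "b = h (w x b) \<or> (b, h (w x b)) \<in> tree_less"
      using w(2) kb_less_total[of b "h (w x b)"] by (auto simp: below_def tree_less_def)
    then show ?thesis using h acc_downward by metis
  qed
  \<comment> \<open>If \<open>h x\<close> were the top, every node would be below it, hence
    accessible.\<close>
  have "tree (h x)"
  proof (rule ccontr)
    assume "\<not> tree (h x)"
    have "b \<in> Wellfounded.acc tree_less" for b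
    proof (cases "tree b")
      case False
      show ?thesis by (rule acc.intros) (use False in \<open>simp add: tree_less_def\<close>)
    qed (use * \<open>\<not> tree (h x)\<close> in \<open>simp add: below_def\<close>)
    then have "wf tree_less" by (intro iffD2[OF wf_iff_acc] allI)
    with not_wf_tree_less show False ..
  qed
  moreover have "h x \<in> Wellfounded.acc tree_less"
    using * by (rule acc.intros) (auto simp: below_def tree_less_def)
  ultimately show ?case ..
qed

text \<open>Numbers outside the tree have no predecessors in \<open>tree_less\<close> and so belong
  to \<open>acc\<close>; restricting \<open>tree_order\<close> discards them.\<close>

definition tree_wf_part :: "nat rel" where
  "tree_wf_part = Restr tree_order (Wellfounded.acc tree_less)"

lemma Field_tree_wf_part: "Field tree_wf_part = {a. tree a} \<inter> Wellfounded.acc tree_less"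
  by (auto simp: tree_wf_part_def Field_def tree_order_def kb_code_def kb_refl)

lemma tree_wf_part_minus_Id:
  "tree_wf_part - Id = {(a, b). (a, b) \<in> tree_less \<and> b \<in> Wellfounded.acc tree_less}"
  using tree_order_minus_Id acc_downward unfolding tree_wf_part_def by fast

lemma wf_tree_wf_part: "wf (tree_wf_part - Id)"
  unfolding wf_iff_acc
proof
  fix a
  show "a \<in> Wellfounded.acc (tree_wf_part - Id)"
  proof (rule acc.intros)
    fix b assume "(b, a) \<in> tree_wf_part - Id"
    then have "b \<in> Wellfounded.acc tree_less"
      unfolding tree_wf_part_minus_Id using acc_downward by fast
    then show "b \<in> Wellfounded.acc (tree_wf_part - Id)"
      by (induction rule: acc.induct) (auto intro: acc.intros simp: tree_wf_part_minus_Id)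
  qed
qed

lemma Well_order_tree_wf_part: "Well_order tree_wf_part"
  using Linear_order_Restr[OF Linear_order_tree_order] wf_tree_wf_part
  by (simp add: well_order_on_def tree_wf_part_def)

text \<open>A computable copy \<open>s\<close> would embed, together with a new top element, strictly monotonically
  into the well-founded part.\<close>

lemma tree_wf_part_not_computable: "\<not> computable_ordinal tree_wf_part"
proof
  assume "computable_ordinal tree_wf_part"
  then obtain s where s: "Well_order s" "computable_rel s" and "(tree_wf_part, s) \<in> ordIso"
    unfolding computable_ordinal_def by blast
  then obtain f where f: "BNF_Wellorder_Embedding.iso tree_wf_part s f" unfolding ordIso_def by blast
  \<comment> \<open>\<open>Suc x\<close> stands for the element \<open>x\<close> of
    \<open>s\<close>, and 0 is the added top; \<open>(y - 1, y - 1) \<in> s\<close> expresses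
    membership in the field.\<close>
  define R where "R y x \<longleftrightarrow> (0 < y \<and> 0 < x \<and> (y - 1, x - 1) \<in> s \<and> y \<noteq> x) \<or>
    (0 < y \<and> x = 0 \<and> (y - 1, y - 1) \<in> s)" for y x
  have "wf (s - Id)" using s(1) by (simp add: well_order_on_def)
  have acc_Suc: "Wellfounded.accp R (Suc x)" for x
    using \<open>wf (s - Id)\<close>
  proof (induction x)
    case (less x)
    show ?case
    proof (rule accp.intros)
      fix y assume "R y (Suc x)"
      then obtain y' where "y = Suc y'" "(y', x) \<in> s - Id" unfolding R_def by (cases y) auto
      then show "Wellfounded.accp R y" using less by blast
    qed
  qed
  have acc: "Wellfounded.accp R x" for x
  proof (rule accp.intros)
    fix y assume "R y x"
    then obtain y' where "y = Suc y'" unfolding R_def by (cases y) auto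
    then show "Wellfounded.accp R y" using acc_Suc by simp
  qed
  have "decidable (\<lambda>z. R (pfst z) (psnd z))"
    unfolding R_def by (intro decidable_rel[OF s(2)] computable_intros)
  then have "computable_rel {(y, x). R y x}" by (intro computable_relI) simp
  then obtain p where p: "\<And>y x. computes p [y, x] (if R y x then 1 else 0)"
    unfolding computable_rel_def by auto
  obtain g where g: "branch g" using branch_exists by blast
  obtain e where "\<And>xs y. computes p xs y \<Longrightarrow> g (posF e (tuple xs)) = y"
    using closed_family_universal[OF branch_closed_family[OF g]] by blast
  from this[OF p] have e: "g (posF e (pair y (pair x 0))) = (if R y x then 1 else 0)" for x y
    by simp
  \<comment> \<open>\<open>p\<close> halts on all inputs, so the relation that the branch ranks at
    index \<open>e\<close> is exactly \<open>R\<close>.\<close>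
  have "(\<lambda>y x. g (posF e (pair y (pair x 0))) = 1) = R" by (simp add: e)
  then obtain h w where ranked: "ranked tree R h w" using branch_ranked[OF g, of e] by metis
  have h_in: "h x \<in> Field tree_wf_part" for x
    using ranked_in_acc[OF ranked acc] by (simp add: Field_tree_wf_part)
  have h_mono: "(h y, h x) \<in> tree_less" if "R y x" for x y
  proof -
    have "tree (h x)" using h_in[of x] by (simp add: Field_tree_wf_part)
    then have "below tree (h y) (h x)" using ranked that by (auto simp: ranked_def)
    then show ?thesis using \<open>tree (h x)\<close> by (simp add: below_def tree_less_def)
  qed
  \<comment> \<open>Isomorphism followed by rank: a strictly increasing map of the well-founded part
    into itself, with values below the rank \<open>h 0\<close> of the top.\<close>
  define k where "k v = h (Suc (f v))" for v
  have k_in: "k v \<in> Field tree_wf_part" for v unfolding k_def by (rule h_in)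
  have k_mono: "(k v, k v') \<in> tree_less" if "(v, v') \<in> tree_less" "v' \<in> Wellfounded.acc tree_less" for v v'
  proof -
    have v: "(v, v') \<in> tree_wf_part" "v \<noteq> v'"
      using that tree_wf_part_minus_Id by blast+
    then have "(f v, f v') \<in> s" using f iso_forward by metis
    moreover have "f v \<noteq> f v'"
      using f v unfolding BNF_Wellorder_Embedding.iso_def bij_betw_def inj_on_def by (meson FieldI1 FieldI2)
    ultimately show ?thesis unfolding k_def by (intro h_mono) (simp add: R_def)
  qed
  \<comment> \<open>A strictly increasing self-map of a well-order moves nothing down: if
    \<open>k v\<close> were below \<open>v\<close>, then \<open>k v\<close> would be a smaller
    element that is moved down as well.\<close>
  have "\<not> (v \<in> Field tree_wf_part \<and> (k v, v) \<in> tree_less)" if "v \<in> Wellfounded.acc tree_less" for v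
    using that
  proof (induction rule: acc.induct)
    case (accI v)
    show ?case
    proof safe
      assume v: "v \<in> Field tree_wf_part" "(k v, v) \<in> tree_less"
      then have "(k (k v), k v) \<in> tree_less" using k_mono accI acc.intros by metis
      then show False using accI v k_in by blast
    qed
  qed
  \<comment> \<open>But \<open>h 0\<close> is moved down, because 0 lies above every
    \<open>Suc x\<close> with \<open>x\<close> in the field of \<open>s\<close>.\<close>
  moreover have "(k (h 0), h 0) \<in> tree_less"
  proof -
    have "f (h 0) \<in> Field s" using f h_in[of 0] unfolding BNF_Wellorder_Embedding.iso_def bij_betw_def by blast
    then have "(f (h 0), f (h 0)) \<in> s"
      using s(1) by (simp add: order_on_defs refl_on_def well_order_on_def)
    then show ?thesis unfolding k_def by (intro h_mono) (simp add: R_def)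
  qed
  ultimately show False using h_in[of 0] by (auto simp: Field_tree_wf_part)
qed

lemma is_omega1_CK_tree_wf_part: "is_omega1_CK tree_wf_part"
  unfolding is_omega1_CK_def
proof (intro conjI allI impI)
  show "Well_order tree_wf_part" by (rule Well_order_tree_wf_part)
  show "\<not> computable_ordinal tree_wf_part" by (rule tree_wf_part_not_computable)
  fix s :: "nat rel"
  assume s: "Well_order s \<and> \<not> computable_ordinal s"
  show "(tree_wf_part, s) \<in> ordLeq"
  proof (rule ccontr)
    assume "\<not> ?thesis"
    then have "(s, tree_wf_part) \<in> ordLess"
      using s Well_order_tree_wf_part not_ordLeq_iff_ordLess by blast
    then obtain a where a: "a \<in> Field tree_wf_part"
      and iso: "(s, Restr tree_wf_part (underS tree_wf_part a)) \<in> ordIso"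
      using s Well_order_tree_wf_part ordLess_iff_ordIso_Restr by blast
    \<comment> \<open>Below an accessible \<open>a\<close> all nodes are accessible. The undecidable
      set \<open>acc\<close> thus drops out of the description of the initial segment, which becomes
      computable.\<close>
    have "x \<in> Wellfounded.acc tree_less" if "kb_less x a" "tree x" for x
      using a that acc_downward[of a tree_less x] by (auto simp: Field_tree_wf_part tree_less_def)
    then have eq: "Restr tree_wf_part (underS tree_wf_part a) =
        {(x, y). tree x \<and> tree y \<and> kb_code x y \<and> kb_less x a \<and> kb_less y a}"
      using a unfolding Field_tree_wf_part
      by (auto simp: underS_def tree_wf_part_def tree_order_def kb_less_def)
    have "computable_rel (Restr tree_wf_part (underS tree_wf_part a))"
      unfolding eq
      by (rule computable_relI)
        (auto intro!: decidable_conj decidable_comp[OF decidable_tree] decidable_kb_code decidable_kb_less computable_intros)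
    moreover have "Well_order (Restr tree_wf_part (underS tree_wf_part a))"
      by (rule Well_order_Restr[OF Well_order_tree_wf_part])
    ultimately have "computable_ordinal s" using iso unfolding computable_ordinal_def by blast
    with s show False by blast
  qed
qed

section \<open>Cantor's theorem on countable dense linear orders\<close>

definition strict_linear_on :: "'a set \<Rightarrow> ('a \<Rightarrow> 'a \<Rightarrow> bool) \<Rightarrow> bool" where
  "strict_linear_on A lt \<longleftrightarrow> (\<forall>a\<in>A. \<not> lt a a) \<and>
     (\<forall>a\<in>A. \<forall>b\<in>A. \<forall>c\<in>A. lt a b \<longrightarrow> lt b c \<longrightarrow> lt a c) \<and>
     (\<forall>a\<in>A. \<forall>b\<in>A. a \<noteq> b \<longrightarrow> lt a b \<or> lt b a)"

definition dense_unbounded_on :: "'a set \<Rightarrow> ('a \<Rightarrow> 'a \<Rightarrow> bool) \<Rightarrow> bool" where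
  "dense_unbounded_on A lt \<longleftrightarrow> strict_linear_on A lt \<and> A \<noteq> {} \<and>
     (\<forall>a\<in>A. \<exists>b\<in>A. lt a b) \<and> (\<forall>a\<in>A. \<exists>b\<in>A. lt b a) \<and>
     (\<forall>a\<in>A. \<forall>b\<in>A. lt a b \<longrightarrow> (\<exists>c\<in>A. lt a c \<and> lt c b))"

lemma strict_linear_on_converse: "strict_linear_on A lt \<Longrightarrow> strict_linear_on A (\<lambda>a b. lt b a)"
  unfolding strict_linear_on_def by blast

lemma finite_strict_linear_max:
  assumes "strict_linear_on A lt" "finite M" "M \<noteq> {}" "M \<subseteq> A"
  shows "\<exists>m\<in>M. \<forall>x\<in>M. x = m \<or> lt x m"
  using assms(2-4)
proof (induction M rule: finite_ne_induct)
  case (insert x M)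
  then obtain m where m: "m \<in> M" "\<forall>y\<in>M. y = m \<or> lt y m" by blast
  note lin = assms(1)[unfolded strict_linear_on_def]
  have A: "x \<in> A" "m \<in> A" "\<And>y. y \<in> M \<Longrightarrow> y \<in> A" using insert m by auto
  consider "lt x m" | "lt m x" using lin A insert.hyps m(1) by metis
  then show ?case
  proof cases
    case 2
    then have "lt y x" if "y \<in> M" for y using lin A m that by metis
    then show ?thesis by blast
  qed (use m in blast)
qed simp

lemma dense_unbounded_finite_gap:
  assumes B: "dense_unbounded_on B lt" and fin: "finite L" "finite U" "L \<subseteq> B" "U \<subseteq> B"
    and LU: "\<And>l u. l \<in> L \<Longrightarrow> u \<in> U \<Longrightarrow> lt l u"
  shows "\<exists>b\<in>B. (\<forall>l\<in>L. lt l b) \<and> (\<forall>u\<in>U. lt b u)"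
proof -
  have lin: "strict_linear_on B lt" using B by (simp add: dense_unbounded_on_def)
  note linD = lin[unfolded strict_linear_on_def]
  have max: "\<exists>m\<in>L. \<forall>x\<in>L. x = m \<or> lt x m" if "L \<noteq> {}"
    by (rule finite_strict_linear_max[OF lin fin(1) that fin(3)])
  have min: "\<exists>m\<in>U. \<forall>x\<in>U. x = m \<or> lt m x" if "U \<noteq> {}"
    by (rule finite_strict_linear_max[OF strict_linear_on_converse[OF lin] fin(2) that fin(4)])
  have above: "\<forall>l\<in>L. lt l b" if "b \<in> B" "lt m b" "m \<in> L" "\<forall>x\<in>L. x = m \<or> lt x m" for b m
    using that linD fin(3) by (metis subsetD)
  have under: "\<forall>u\<in>U. lt b u" if "b \<in> B" "lt b m" "m \<in> U" "\<forall>x\<in>U. x = m \<or> lt m x" for b m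
    using that linD fin(4) by (metis subsetD)
  consider "L = {}" "U = {}" | "L = {}" "U \<noteq> {}" | "L \<noteq> {}" "U = {}" | "L \<noteq> {}" "U \<noteq> {}" by blast
  then show ?thesis
  proof cases
    case 1
    then show ?thesis using B by (auto simp: dense_unbounded_on_def)
  next
    case 2
    then obtain m where m: "m \<in> U" "\<forall>x\<in>U. x = m \<or> lt m x" using min by blast
    then obtain b where b: "b \<in> B" "lt b m" using B fin(4) m(1) unfolding dense_unbounded_on_def by blast
    then show ?thesis using under[OF b m] 2 by blast
  next
    case 3
    then obtain m where m: "m \<in> L" "\<forall>x\<in>L. x = m \<or> lt x m" using max by blast
    then obtain b where b: "b \<in> B" "lt m b" using B fin(3) m(1) unfolding dense_unbounded_on_def by blast
    then show ?thesis using above[OF b m] 3 by blast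
  next
    case 4
    obtain m where m: "m \<in> L" "\<forall>x\<in>L. x = m \<or> lt x m" using max 4 by blast
    obtain k where k: "k \<in> U" "\<forall>x\<in>U. x = k \<or> lt k x" using min 4 by blast
    have "lt m k" "m \<in> B" "k \<in> B" using LU m k fin by auto
    then obtain b where b: "b \<in> B" "lt m b" "lt b k"
      using B unfolding dense_unbounded_on_def by blast
    then show ?thesis using above[OF b(1,2) m] under[OF b(1,3) k] by blast
  qed
qed

definition partial_iso :: "('a \<Rightarrow> 'a \<Rightarrow> bool) \<Rightarrow> ('b \<Rightarrow> 'b \<Rightarrow> bool) \<Rightarrow> ('a \<times> 'b) set \<Rightarrow> bool" where
  "partial_iso lt lt' p \<longleftrightarrow> (\<forall>a b a' b'. (a, b) \<in> p \<longrightarrow> (a', b') \<in> p \<longrightarrow>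
     (lt a a' \<longleftrightarrow> lt' b b') \<and> (a = a' \<longleftrightarrow> b = b'))"

lemma partial_iso_converse: "partial_iso lt' lt (p\<inverse>) \<longleftrightarrow> partial_iso lt lt' p"
  unfolding partial_iso_def by auto

text \<open>The forth step of the back-and-forth argument; the back step is the same lemma applied
  to the converse.\<close>

lemma partial_iso_extend:
  assumes A: "strict_linear_on A lt" and B: "dense_unbounded_on B lt'"
    and p: "partial_iso lt lt' p" "finite p" "p \<subseteq> A \<times> B" and a: "a \<in> A"
  shows "\<exists>b\<in>B. partial_iso lt lt' (insert (a, b) p)"
proof (cases "a \<in> Domain p")
  case True
  then obtain b where "(a, b) \<in> p" by blast
  then show ?thesis using p by (intro bexI[of _ b]) (auto simp: insert_absorb)
next
  case False
  \<comment> \<open>\<open>L\<close> and \<open>U\<close> hold the partners of the points below and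
    above \<open>a\<close>; the partner of \<open>a\<close> goes into the gap between these finite
    sets.\<close>
  define L where "L = snd ` {(c, b) \<in> p. lt c a}"
  define U where "U = snd ` {(c, b) \<in> p. lt a c}"
  note Ad = A[unfolded strict_linear_on_def]
  have B': "strict_linear_on B lt'" using B by (simp add: dense_unbounded_on_def)
  note Bd = B'[unfolded strict_linear_on_def]
  have fin: "finite L" "finite U" "L \<subseteq> B" "U \<subseteq> B"
    using p by (auto simp: L_def U_def intro: rev_finite_subset[OF p(2)])
  have LU: "lt' l u" if lu: "l \<in> L" "u \<in> U" for l u
  proof -
    obtain c d where cd: "(c, l) \<in> p" "lt c a" "(d, u) \<in> p" "lt a d"
      using lu by (auto simp: L_def U_def)
    then have "c \<in> A" "d \<in> A" using p by auto
    then have "lt c d" using cd a Ad by blast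
    then show ?thesis using cd p(1) unfolding partial_iso_def by blast
  qed
  from dense_unbounded_finite_gap[OF B fin LU]
  obtain b where b: "b \<in> B" "\<And>l. l \<in> L \<Longrightarrow> lt' l b" "\<And>u. u \<in> U \<Longrightarrow> lt' b u" by blast
  have new: "(lt a c \<longleftrightarrow> lt' b d) \<and> (lt c a \<longleftrightarrow> lt' d b) \<and> a \<noteq> c \<and> b \<noteq> d" if cd: "(c, d) \<in> p" for c d
  proof -
    have cd': "c \<in> A" "d \<in> B" "a \<noteq> c" using p cd False by auto
    then consider "lt a c" "\<not> lt c a" | "lt c a" "\<not> lt a c" using Ad a by metis
    then show ?thesis
    proof cases
      case 1
      then have "d \<in> U" using cd by (force simp: U_def)
      then show ?thesis using 1 b Bd cd' by metis
    next
      case 2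
      then have "d \<in> L" using cd by (force simp: L_def)
      then show ?thesis using 2 b Bd cd' by metis
    qed
  qed
  have "partial_iso lt lt' (insert (a, b) p)"
    unfolding partial_iso_def
  proof (intro allI impI)
    fix c d c' d'
    assume c: "(c, d) \<in> insert (a, b) p" and c': "(c', d') \<in> insert (a, b) p"
    have irrefl: "\<not> lt a a" "\<not> lt' b b" using Ad[THEN conjunct1] Bd[THEN conjunct1] a b(1) by simp_all
    consider "(c, d) = (a, b)" "(c', d') = (a, b)" | "(c, d) = (a, b)" "(c', d') \<in> p"
      | "(c, d) \<in> p" "(c', d') = (a, b)" | "(c, d) \<in> p" "(c', d') \<in> p"
      using c c' by blast
    then show "(lt c c' \<longleftrightarrow> lt' d d') \<and> (c = c' \<longleftrightarrow> d = d')"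
    proof cases
      case 1
      then show ?thesis using irrefl by simp
    next
      case 2
      then show ?thesis using new[of c' d'] by simp
    next
      case 3
      then show ?thesis using new[of c d] by auto
    next
      case 4
      then show ?thesis using p(1) unfolding partial_iso_def by blast
    qed
  qed
  then show ?thesis using b by blast
qed

theorem cantor_dense_unbounded:
  assumes A: "dense_unbounded_on A lt" "countable A" and B: "dense_unbounded_on B lt'" "countable B"
  shows "\<exists>f. bij_betw f A B \<and> (\<forall>a\<in>A. \<forall>b\<in>A. lt a b \<longleftrightarrow> lt' (f a) (f b))"
proof -
  have ne: "A \<noteq> {}" "B \<noteq> {}" using A B by (auto simp: dense_unbounded_on_def)
  have lin: "strict_linear_on A lt" "strict_linear_on B lt'"
    using A B by (auto simp: dense_unbounded_on_def)
  define good where "good p \<longleftrightarrow> partial_iso lt lt' p \<and> finite p \<and> p \<subseteq> A \<times> B" for p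
  \<comment> \<open>Stage \<open>n\<close> puts the \<open>n\<close>-th element of \<open>A\<close>
    into the domain and that of \<open>B\<close> into the range, so the union of the stages is total
    and onto.\<close>
  have step: "\<exists>q. good q \<and> (p \<subseteq> q \<and> from_nat_into A n \<in> Domain q \<and> from_nat_into B n \<in> Range q)"
    if p: "good p" for p n
  proof -
    let ?a = "from_nat_into A n" and ?b = "from_nat_into B n"
    have ab: "?a \<in> A" "?b \<in> B" using from_nat_into[OF ne(1)] from_nat_into[OF ne(2)] by auto
    obtain b where b: "b \<in> B" "partial_iso lt lt' (insert (?a, b) p)"
      using partial_iso_extend[OF lin(1) B(1) _ _ _ ab(1)] p unfolding good_def by blast
    let ?q = "insert (?a, b) p"
    have "good ?q" using b p ab by (auto simp: good_def)
    then have "partial_iso lt' lt (?q\<inverse>)" "finite (?q\<inverse>)" "?q\<inverse> \<subseteq> B \<times> A"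
      unfolding good_def partial_iso_converse by auto
    from partial_iso_extend[OF lin(2) A(1) this ab(2)]
    obtain a where a: "a \<in> A" "partial_iso lt' lt (insert (?b, a) (?q\<inverse>))" by blast
    have "insert (?b, a) (?q\<inverse>) = (insert (a, ?b) ?q)\<inverse>" by auto
    with a(2) have "partial_iso lt lt' (insert (a, ?b) ?q)" by (metis partial_iso_converse)
    then have "good (insert (a, ?b) ?q)" using \<open>good ?q\<close> a ab by (auto simp: good_def)
    then show ?thesis by (intro exI[of _ "insert (a, ?b) ?q"]) auto
  qed
  have "\<exists>p. \<forall>n. good (p n) \<and>
      (p n \<subseteq> p (Suc n) \<and> from_nat_into A n \<in> Domain (p (Suc n)) \<and> from_nat_into B n \<in> Range (p (Suc n)))"
    by (rule dependent_nat_choice) (use step in \<open>auto simp: good_def partial_iso_def\<close>)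
  then obtain p where p: "\<And>n. good (p n)" "\<And>n. p n \<subseteq> p (Suc n)"
    "\<And>n. from_nat_into A n \<in> Domain (p (Suc n))" "\<And>n. from_nat_into B n \<in> Range (p (Suc n))"
    by blast
  define G where "G = (\<Union>n. p n)"
  have mono: "p m \<subseteq> p n" if "m \<le> n" for m n using p(2) that by (rule lift_Suc_mono_le)
  have G: "(lt a a' \<longleftrightarrow> lt' b b') \<and> (a = a' \<longleftrightarrow> b = b')" if "(a, b) \<in> G" "(a', b') \<in> G" for a b a' b'
  proof -
    obtain m n where "(a, b) \<in> p m" "(a', b') \<in> p n" using \<open>(a, b) \<in> G\<close> \<open>(a', b') \<in> G\<close> by (auto simp: G_def)
    then have "(a, b) \<in> p (max m n)" "(a', b') \<in> p (max m n)"
      using mono[of m "max m n"] mono[of n "max m n"] by auto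
    then show ?thesis using p(1)[of "max m n"] unfolding good_def partial_iso_def by blast
  qed
  have sub: "G \<subseteq> A \<times> B" using p(1) by (auto simp: G_def good_def)
  have dom: "\<exists>b. (a, b) \<in> G" if "a \<in> A" for a
    using p(3) from_nat_into_surj[OF A(2) that] by (fastforce simp: G_def)
  have ran: "\<exists>a. (a, b) \<in> G" if "b \<in> B" for b
    using p(4) from_nat_into_surj[OF B(2) that] by (fastforce simp: G_def)
  define f where "f a = (SOME b. (a, b) \<in> G)" for a
  have f: "(a, f a) \<in> G" if "a \<in> A" for a
    unfolding f_def using dom[OF that] by (rule someI_ex)
  have "bij_betw f A B"
    unfolding bij_betw_def
  proof
    show "inj_on f A" using f G by (metis inj_onI)
    show "f ` A = B"
    proof
      show "f ` A \<subseteq> B" using f sub by blast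
      show "B \<subseteq> f ` A"
      proof
        fix b assume "b \<in> B"
        then obtain a where a: "(a, b) \<in> G" using ran by blast
        then have "a \<in> A" using sub by blast
        then have "f a = b" using a f G by metis
        then show "b \<in> f ` A" using \<open>a \<in> A\<close> by blast
      qed
    qed
  qed
  then show ?thesis using f G by blast
qed

section \<open>Powers of the integers\<close>

definition Z_less :: "'a rel \<Rightarrow> ('a \<Rightarrow> int) \<Rightarrow> ('a \<Rightarrow> int) \<Rightarrow> bool" where
  "Z_less X f g \<longleftrightarrow> (\<exists>x\<in>Field X. f x < g x \<and> (\<forall>y\<in>Field X. f y \<noteq> g y \<longrightarrow> (y, x) \<in> X))"

lemma Z_pow_iff: "(f, g) \<in> Z_pow X \<longleftrightarrow> f \<in> fin_supp X \<and> g \<in> fin_supp X \<and> (f = g \<or> Z_less X f g)"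
  by (simp add: Z_pow_def Z_less_def)

lemma Linear_order_strict_linear_on:
  assumes "Linear_order X" shows "strict_linear_on (Field X) (\<lambda>a b. (a, b) \<in> X \<and> a \<noteq> b)"
  using assms unfolding strict_linear_on_def order_on_defs trans_def antisym_def total_on_def by metis

lemma Z_less_irrefl: "\<not> Z_less X f f"
  by (simp add: Z_less_def)

text \<open>Of the two deciding positions, the larger one decides between \<open>f\<close> and
  \<open>h\<close>.\<close>

lemma Z_less_trans:
  assumes X: "Linear_order X" and fg: "Z_less X f g" and gh: "Z_less X g h"
  shows "Z_less X f h"
proof -
  have tr: "(a, b) \<in> X \<Longrightarrow> (b, c) \<in> X \<Longrightarrow> (a, c) \<in> X" for a b c
    using X unfolding order_on_defs trans_def by blast
  have as: "(a, b) \<in> X \<Longrightarrow> (b, a) \<in> X \<Longrightarrow> a = b" for a b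
    using X unfolding order_on_defs antisym_def by blast
  obtain x where x: "x \<in> Field X" "f x < g x" "\<And>z. z \<in> Field X \<Longrightarrow> f z \<noteq> g z \<Longrightarrow> (z, x) \<in> X"
    using fg unfolding Z_less_def by blast
  obtain y where y: "y \<in> Field X" "g y < h y" "\<And>z. z \<in> Field X \<Longrightarrow> g z \<noteq> h z \<Longrightarrow> (z, y) \<in> X"
    using gh unfolding Z_less_def by blast
  have "x = y \<or> (x, y) \<in> X \<and> x \<noteq> y \<or> (y, x) \<in> X \<and> x \<noteq> y"
    using X x(1) y(1) unfolding order_on_defs total_on_def by blast
  then consider "x = y" | "(x, y) \<in> X" "x \<noteq> y" | "(y, x) \<in> X" "x \<noteq> y" by blast
  then show ?thesis
  proof cases
    case 1
    then show ?thesis unfolding Z_less_def using x y by (intro bexI[of _ x]) force+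
  next
    case 2
    then have "f y = g y" using x(3) y(1) as by blast
    moreover have "(z, y) \<in> X" if "z \<in> Field X" "f z \<noteq> h z" for z
      using that x(3) y(3) tr 2 by metis
    ultimately show ?thesis unfolding Z_less_def using y by (intro bexI[of _ y]) auto
  next
    case 3
    then have "g x = h x" using y(3) x(1) as by blast
    moreover have "(z, x) \<in> X" if "z \<in> Field X" "f z \<noteq> h z" for z
      using that x(3) y(3) tr 3 by metis
    ultimately show ?thesis unfolding Z_less_def using x by (intro bexI[of _ x]) auto
  qed
qed

lemma Z_less_total:
  assumes X: "Linear_order X" and f: "f \<in> fin_supp X" and g: "g \<in> fin_supp X" and "f \<noteq> g"
  shows "Z_less X f g \<or> Z_less X g f"
proof -
  let ?D = "{x. f x \<noteq> g x}"
  have sub: "?D \<subseteq> {x. f x \<noteq> 0} \<union> {x. g x \<noteq> 0}" by auto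
  have D: "finite ?D" "?D \<noteq> {}" "?D \<subseteq> Field X"
    using finite_subset[OF sub] sub f g \<open>f \<noteq> g\<close> by (auto simp: fin_supp_def)
  obtain x where x: "x \<in> ?D" "\<And>y. y \<in> ?D \<Longrightarrow> y = x \<or> (y, x) \<in> X"
    using finite_strict_linear_max[OF Linear_order_strict_linear_on[OF X] D] by blast
  have "(x, x) \<in> X" using x(1) D(3) X unfolding order_on_defs refl_on_def by blast
  then have "\<forall>y\<in>Field X. f y \<noteq> g y \<longrightarrow> (y, x) \<in> X" "\<forall>y\<in>Field X. g y \<noteq> f y \<longrightarrow> (y, x) \<in> X"
    using x(2) by force+
  moreover have "f x < g x \<or> g x < f x" "x \<in> Field X" using x(1) D(3) by auto
  ultimately show ?thesis unfolding Z_less_def by blast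
qed

lemma strict_linear_on_Z_less:
  assumes "Linear_order X" shows "strict_linear_on (fin_supp X) (Z_less X)"
  unfolding strict_linear_on_def
  using Z_less_irrefl Z_less_trans[OF assms] Z_less_total[OF assms] by blast

lemma Linear_order_Z_pow:
  assumes "Linear_order X" shows "linear_order_on (fin_supp X) (Z_pow X)"
  unfolding order_on_defs
proof (intro conjI)
  show "Z_pow X \<subseteq> fin_supp X \<times> fin_supp X" "refl_on (fin_supp X) (Z_pow X)"
    by (auto simp: refl_on_def Z_pow_iff)
  show "trans (Z_pow X)"
    using Z_less_trans[OF assms] unfolding trans_def Z_pow_iff by blast
  show "antisym (Z_pow X)"
    using Z_less_trans[OF assms] Z_less_irrefl unfolding antisym_def Z_pow_iff by blast
  show "total_on (fin_supp X) (Z_pow X)"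
    using Z_less_total[OF assms] unfolding total_on_def Z_pow_iff by blast
qed

lemma fin_supp_add: "f \<in> fin_supp X \<Longrightarrow> g \<in> fin_supp X \<Longrightarrow> (\<lambda>x. f x + g x) \<in> fin_supp X"
proof -
  assume fg: "f \<in> fin_supp X" "g \<in> fin_supp X"
  have sub: "{x. f x + g x \<noteq> 0} \<subseteq> {x. f x \<noteq> 0} \<union> {x. g x \<noteq> 0}" by auto
  then show ?thesis using finite_subset[OF sub] fg unfolding fin_supp_def by blast
qed

lemma fin_supp_uminus: "f \<in> fin_supp X \<Longrightarrow> (\<lambda>x. - f x) \<in> fin_supp X"
  by (simp add: fin_supp_def)

lemma fin_supp_zero: "(\<lambda>x. 0) \<in> fin_supp X"
  by (simp add: fin_supp_def)

lemma fin_supp_upd: "f \<in> fin_supp X \<Longrightarrow> x \<in> Field X \<Longrightarrow> f(x := v) \<in> fin_supp X"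
  unfolding fin_supp_def by (auto intro: rev_finite_subset[of "insert x {x. f x \<noteq> 0}"])

lemma Z_pow_add_right:
  "(f, g) \<in> Z_pow X \<Longrightarrow> h \<in> fin_supp X \<Longrightarrow> ((\<lambda>x. f x + h x), (\<lambda>x. g x + h x)) \<in> Z_pow X"
  by (auto simp: Z_pow_iff fin_supp_add Z_less_def)

lemma dense_unbounded_Z_less:
  assumes X: "Linear_order X" and ne: "Field X \<noteq> {}"
    and no_least: "\<And>x. x \<in> Field X \<Longrightarrow> \<exists>y. (y, x) \<in> X \<and> y \<noteq> x"
  shows "dense_unbounded_on (fin_supp X) (Z_less X)"
  unfolding dense_unbounded_on_def
proof (intro conjI ballI impI)
  have refl: "x \<in> Field X \<Longrightarrow> (x, x) \<in> X" for x using X unfolding order_on_defs refl_on_def by blast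
  show "strict_linear_on (fin_supp X) (Z_less X)" by (rule strict_linear_on_Z_less[OF X])
  show "fin_supp X \<noteq> {}" using fin_supp_zero by blast
  obtain x where x: "x \<in> Field X" using ne by blast
  fix f assume f: "f \<in> fin_supp X"
  have "Z_less X f (f(x := f x + 1))" "Z_less X (f(x := f x - 1)) f"
    using x refl by (auto simp: Z_less_def intro!: bexI[of _ x])
  then show "\<exists>g\<in>fin_supp X. Z_less X f g" "\<exists>g\<in>fin_supp X. Z_less X g f"
    using fin_supp_upd[OF f x] by blast+
  fix g assume g: "g \<in> fin_supp X" and "Z_less X f g"
  then obtain m where m: "m \<in> Field X" "f m < g m" "\<forall>y\<in>Field X. f y \<noteq> g y \<longrightarrow> (y, m) \<in> X"
    unfolding Z_less_def by blast
  \<comment> \<open>Raising \<open>f\<close> at a position \<open>y\<close> below the deciding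
    position \<open>m\<close> exceeds \<open>f\<close>, while \<open>m\<close> still decides the
    comparison with \<open>g\<close>.\<close>
  obtain y where y: "(y, m) \<in> X" "y \<noteq> m" using no_least[OF m(1)] by blast
  then have yF: "y \<in> Field X" by (blast intro: FieldI1)
  let ?h = "f(y := f y + 1)"
  have "Z_less X f ?h" using yF refl by (auto simp: Z_less_def intro!: bexI[of _ y])
  moreover have "Z_less X ?h g" unfolding Z_less_def using m y by (intro bexI[of _ m]) auto
  ultimately show "\<exists>h\<in>fin_supp X. Z_less X f h \<and> Z_less X h g" using fin_supp_upd[OF f yF] by blast
qed

section \<open>Splitting the exponent into an initial segment and its complement\<close>

definition restrict0 :: "'a set \<Rightarrow> ('a \<Rightarrow> int) \<Rightarrow> 'a \<Rightarrow> int" where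
  "restrict0 A f x = (if x \<in> A then f x else 0)"

lemma Field_Restr_Linear_order:
  assumes "Linear_order X" shows "Field (Restr X A) = Field X \<inter> A"
  using assms unfolding order_on_defs refl_on_def Field_def by blast

lemma bij_betw_restrict0:
  assumes X: "Linear_order X"
  shows "bij_betw (\<lambda>f. (restrict0 A f, restrict0 (- A) f)) (fin_supp X)
    (fin_supp (Restr X A) \<times> fin_supp (Restr X (- A)))"
proof (rule bij_betw_byWitness[where f' = "\<lambda>(f, g) x. f x + g x"])
  show "\<forall>f\<in>fin_supp X. (case (restrict0 A f, restrict0 (- A) f) of (f, g) \<Rightarrow> \<lambda>x. f x + g x) = f"
    by (auto simp: restrict0_def)
  show "\<forall>fg\<in>fin_supp (Restr X A) \<times> fin_supp (Restr X (- A)).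
      (restrict0 A (case fg of (f, g) \<Rightarrow> \<lambda>x. f x + g x),
       restrict0 (- A) (case fg of (f, g) \<Rightarrow> \<lambda>x. f x + g x)) = fg"
    by (auto simp: restrict0_def fin_supp_def Field_Restr_Linear_order[OF X] fun_eq_iff)
  show "(\<lambda>f. (restrict0 A f, restrict0 (- A) f)) ` fin_supp X
      \<subseteq> fin_supp (Restr X A) \<times> fin_supp (Restr X (- A))"
    by (auto simp: restrict0_def fin_supp_def Field_Restr_Linear_order[OF X]
        intro: rev_finite_subset split: if_splits)
  show "(\<lambda>(f, g) x. f x + g x) ` (fin_supp (Restr X A) \<times> fin_supp (Restr X (- A))) \<subseteq> fin_supp X"
  proof safe
    fix f g assume "f \<in> fin_supp (Restr X A)" "g \<in> fin_supp (Restr X (- A))"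
    then show "(\<lambda>x. f x + g x) \<in> fin_supp X"
      by (intro fin_supp_add) (auto simp: fin_supp_def Field_Restr_Linear_order[OF X])
  qed
qed

text \<open>\<open>A\<close> is an initial segment, hence less significant than its complement.\<close>

lemma Z_pow_restrict0:
  assumes X: "Linear_order X" and A: "\<And>x y. (y, x) \<in> X \<Longrightarrow> x \<in> A \<Longrightarrow> y \<in> A"
    and f: "f \<in> fin_supp X" and g: "g \<in> fin_supp X"
  shows "(f, g) \<in> Z_pow X \<longleftrightarrow> Z_less (Restr X (- A)) (restrict0 (- A) f) (restrict0 (- A) g) \<or>
    restrict0 (- A) f = restrict0 (- A) g \<and> (restrict0 A f, restrict0 A g) \<in> Z_pow (Restr X A)"
    (is "_ \<longleftrightarrow> ?R f g")
proof -
  have bij: "restrict0 A h \<in> fin_supp (Restr X A)" "restrict0 (- A) h \<in> fin_supp (Restr X (- A))"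
    if "h \<in> fin_supp X" for h
    using bij_betw_apply[OF bij_betw_restrict0[OF X] that, of A] by auto
  have eq: "h = k" if "restrict0 (- A) h = restrict0 (- A) k" "restrict0 A h = restrict0 A k" for h k
    using that by (metis Compl_iff ext restrict0_def)
  have tot: "y \<in> A \<Longrightarrow> x \<notin> A \<Longrightarrow> x \<in> Field X \<Longrightarrow> y \<in> Field X \<Longrightarrow> (y, x) \<in> X" for x y
    using X A unfolding order_on_defs total_on_def by metis
  have less: "Z_less X h k" if hk: "?R h k" "h \<noteq> k" "h \<in> fin_supp X" "k \<in> fin_supp X" for h k
    using hk(1)
  proof
    assume "Z_less (Restr X (- A)) (restrict0 (- A) h) (restrict0 (- A) k)"
    then obtain x where x: "x \<in> Field X" "x \<notin> A" "h x < k x"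
      "\<And>y. y \<in> Field X \<Longrightarrow> y \<notin> A \<Longrightarrow> h y \<noteq> k y \<Longrightarrow> (y, x) \<in> X"
      unfolding Z_less_def Field_Restr_Linear_order[OF X] by (auto simp: restrict0_def)
    then have "\<forall>y\<in>Field X. h y \<noteq> k y \<longrightarrow> (y, x) \<in> X" using tot by blast
    then show ?thesis unfolding Z_less_def using x by blast
  next
    assume *: "restrict0 (- A) h = restrict0 (- A) k \<and> (restrict0 A h, restrict0 A k) \<in> Z_pow (Restr X A)"
    then have hk_eq: "h y = k y" if "y \<notin> A" for y using that by (metis Compl_iff restrict0_def)
    have "Z_less (Restr X A) (restrict0 A h) (restrict0 A k)"
      using * eq hk(2) by (auto simp: Z_pow_iff)
    then obtain x where x: "x \<in> Field X" "x \<in> A" "h x < k x"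
      "\<And>y. y \<in> Field X \<Longrightarrow> y \<in> A \<Longrightarrow> h y \<noteq> k y \<Longrightarrow> (y, x) \<in> X"
      unfolding Z_less_def Field_Restr_Linear_order[OF X] by (auto simp: restrict0_def)
    then show ?thesis unfolding Z_less_def using hk_eq by (intro bexI[of _ x]) auto
  qed
  \<comment> \<open>Totality of the right-hand side yields the converse of \<open>less\<close>: if
    the right-hand side failed for \<open>f\<close> and \<open>g\<close>, it would hold for
    \<open>g\<close> and \<open>f\<close>, forcing both strict inequalities.\<close>
  have tot_R: "?R f g \<or> ?R g f"
    using Z_less_total[OF Linear_order_Restr[OF X, of "- A"] bij(2)[OF f] bij(2)[OF g]]
      Z_less_total[OF Linear_order_Restr[OF X, of A] bij(1)[OF f] bij(1)[OF g]] bij(1)[OF f] bij(1)[OF g]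
    unfolding Z_pow_iff by metis
  show ?thesis
  proof
    assume fg: "(f, g) \<in> Z_pow X"
    show "?R f g"
    proof (rule ccontr)
      assume "\<not> ?R f g"
      then have "?R g f" using tot_R by blast
      moreover have "f \<noteq> g" using \<open>\<not> ?R f g\<close> bij(1)[OF f] by (auto simp: Z_pow_iff)
      ultimately have "Z_less X g f" "Z_less X f g" using less f g fg by (auto simp: Z_pow_iff)
      then show False using Z_less_trans[OF X] Z_less_irrefl by blast
    qed
  next
    assume "?R f g"
    then show "(f, g) \<in> Z_pow X" using less f g by (cases "f = g") (auto simp: Z_pow_iff)
  qed
qed

section \<open>Computable presentations of powers of the integers\<close>

text \<open>Recursion goes into the first component, because only this one is smaller than the
  code for every nonzero code; hence every number codes a finitely supported function.\<close>

definition digit :: "nat \<Rightarrow> nat \<Rightarrow> nat" where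
  "digit c i = psnd (rec_nat c (\<lambda>m y. pfst y) i)"

lemma digit_0: "digit c 0 = psnd c"
  by (simp add: digit_def)

lemma digit_Suc: "digit c (Suc i) = digit (pfst c) i"
proof -
  have "rec_nat c (\<lambda>m y. pfst y) (Suc i) = rec_nat (pfst c) (\<lambda>m y. pfst y) i"
    by (induction i) auto
  then show ?thesis by (simp add: digit_def)
qed

lemma digit_zero: "digit 0 i = 0"
  by (induction i) (auto simp: digit_0 digit_Suc)

text \<open>Each step to \<open>pfst\<close> shrinks a nonzero code, so nothing is left after
  \<open>c\<close> steps. A code thereby bounds its own support, which makes the quantifiers over
  positions bounded.\<close>

lemma digit_eq_0: "c \<le> i \<Longrightarrow> digit c i = 0"
proof (induction i arbitrary: c)
  case (Suc i)
  show ?case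
  proof (cases "c = 0")
    case False
    then have "pfst c \<le> i" using pfst_less[of c] Suc.prems by simp
    then show ?thesis by (simp add: digit_Suc Suc.IH)
  qed (simp add: digit_zero)
qed (simp add: digit_zero)

lemma digit_less: "digit c i \<noteq> 0 \<Longrightarrow> i < c"
  using digit_eq_0[of c i] by (cases "c \<le> i") auto

lemma digit_inject: "(\<forall>i. digit a i = digit b i) \<Longrightarrow> a = b"
proof (induction "a + b" arbitrary: a b rule: less_induct)
  case less
  show ?case
  proof (cases "a + b = 0")
    case False
    have eq: "psnd a = psnd b" "\<forall>i. digit (pfst a) i = digit (pfst b) i"
      using less.prems by (metis digit_0, metis digit_Suc)
    have "pfst a + pfst b < a + b"
      using False pfst_less[of a] pfst_less[of b] pfst_le[of a] pfst_le[of b]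
      by (cases "a = 0") auto
    then have "pfst a = pfst b" using eq(2) by (rule less.hyps)
    with eq(1) show ?thesis by (metis pair_pfst_psnd)
  qed simp
qed

lemma digit_surj: "(\<forall>i\<ge>n. f i = 0) \<Longrightarrow> \<exists>c. digit c = f"
proof (induction n arbitrary: f)
  case 0
  then have "digit 0 = f" by (auto simp: digit_zero)
  then show ?case by blast
next
  case (Suc n)
  then obtain c where c: "digit c = (\<lambda>i. f (Suc i))" by force
  have "digit (pair c (f 0)) i = f i" for i
    by (cases i) (simp_all add: digit_0 digit_Suc c)
  then show ?case by blast
qed

definition dec :: "nat \<Rightarrow> nat \<Rightarrow> int" where
  "dec c i = int_decode (digit c i)"

definition enc :: "(nat \<Rightarrow> int) \<Rightarrow> nat" where
  "enc f = (SOME c. dec c = f)"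

lemma int_encode_0: "int_encode 0 = 0"
  by (simp add: int_encode_def sum_encode_def)

lemma int_decode_0: "int_decode 0 = 0"
  by (metis int_encode_0 int_encode_inverse)

lemma dec_inject: "dec a = dec b \<Longrightarrow> a = b"
  by (rule digit_inject) (metis dec_def int_decode_inverse)

lemma dec_eq_iff: "dec a = dec b \<longleftrightarrow> a = b"
  using dec_inject by blast

lemma dec_enc: "f \<in> fin_supp X \<Longrightarrow> dec (enc f) = f"
proof -
  assume "f \<in> fin_supp X"
  then obtain n where n: "\<forall>i. f i \<noteq> 0 \<longrightarrow> i < n"
    using finite_nat_bounded[of "{x. f x \<noteq> 0}"] by (auto simp: fin_supp_def)
  then have "\<forall>i\<ge>n. int_encode (f i) = 0" using int_encode_0 by (metis not_le)
  from digit_surj[OF this] obtain c where "digit c = (\<lambda>i. int_encode (f i))" by blast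
  then have "dec c = f" by (auto simp: dec_def)
  then show ?thesis unfolding enc_def by (rule someI)
qed

lemma enc_dec: "enc (dec c) = c"
  unfolding enc_def by (rule someI2[of _ c]) (auto intro: dec_inject)

lemma dec_eq_0_iff: "dec c i = 0 \<longleftrightarrow> digit c i = 0"
  unfolding dec_def by (metis int_decode_0 int_decode_inverse)

lemma dec_0: "dec 0 = (\<lambda>i. 0)"
  by (simp add: dec_def digit_zero int_decode_0 fun_eq_iff)

text \<open>\<open>int_decode\<close> reads even numbers as nonnegative and odd ones as negative
  integers. Writing an integer as a difference of naturals brings its order and addition within
  reach of the closure rules.\<close>

definition pos_part :: "nat \<Rightarrow> nat" where
  "pos_part n = (if even n then n div 2 else 0)"

definition neg_part :: "nat \<Rightarrow> nat" where
  "neg_part n = (if even n then 0 else Suc (n div 2))"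

lemma int_decode_parts: "int_decode n = int (pos_part n) - int (neg_part n)"
  by (simp add: int_decode_def sum_decode_def pos_part_def neg_part_def)

lemma int_encode_diff: "int_encode (int p - int q) = (if q \<le> p then (p - q) + (p - q) else (q - p) + (q - p) - 1)"
proof (cases "q \<le> p")
  case True
  then have "nat (int p - int q) = p - q" by (simp add: of_nat_diff)
  then show ?thesis using True by (simp add: int_encode_def sum_encode_def)
next
  case False
  then have "nat (- (int p - int q) - 1) = q - p - 1" by arith
  then show ?thesis using False by (simp add: int_encode_def sum_encode_def)
qed

lemma decidable_even: "computable1 f \<Longrightarrow> decidable (\<lambda>x. even (f x))"
proof -
  assume f: "computable1 f"
  have "rec_nat 0 (\<lambda>m y. 1 - y) n = (if even n then 0 else 1 :: nat)" for n
    by (induction n) auto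
  then have "rec_nat 0 (\<lambda>m y. 1 - y) n = (0 :: nat) \<longleftrightarrow> even n" for n
    by simp
  moreover have "decidable (\<lambda>x. rec_nat 0 (\<lambda>m y. 1 - y) (f x) = (0 :: nat))"
    by (intro decidable_eq computable_rec f computable_intros)
  ultimately show ?thesis by simp
qed

lemma computable_div2: "computable1 f \<Longrightarrow> computable1 (\<lambda>x. f x div 2)"
proof -
  assume f: "computable1 f"
  have "rec_nat 0 (\<lambda>m y. y + (if even m then 0 else 1)) n = n div 2" for n :: nat
    by (induction n) auto
  moreover have "computable1 (\<lambda>x. rec_nat 0 (\<lambda>m y. y + (if even m then 0 else 1)) (f x))"
    by (intro computable_rec f decidable_even computable_intros)
  ultimately show ?thesis by simp
qed

lemma computable_pos_part: "computable1 f \<Longrightarrow> computable1 (\<lambda>x. pos_part (f x))"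
  and computable_neg_part: "computable1 f \<Longrightarrow> computable1 (\<lambda>x. neg_part (f x))"
  unfolding pos_part_def neg_part_def by (intro decidable_even computable_div2 computable_intros; assumption)+

lemma computable_digit: "computable1 f \<Longrightarrow> computable1 g \<Longrightarrow> computable1 (\<lambda>x. digit (f x) (g x))"
  unfolding digit_def by (intro computable_rec computable_intros)

definition add_code :: "nat \<Rightarrow> nat \<Rightarrow> nat" where
  "add_code m n = int_encode (int_decode m + int_decode n)"

lemma computable_add_code: "computable1 f \<Longrightarrow> computable1 g \<Longrightarrow> computable1 (\<lambda>x. add_code (f x) (g x))"
proof -
  assume fg: "computable1 f" "computable1 g"
  have "add_code m n = (let p = pos_part m + pos_part n; q = neg_part m + neg_part n in
      if q \<le> p then (p - q) + (p - q) else (q - p) + (q - p) - 1)" for m n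
    unfolding Let_def int_encode_diff[symmetric] by (simp add: add_code_def int_decode_parts algebra_simps)
  then show ?thesis
    unfolding Let_def by (simp only:) (intro computable_pos_part computable_neg_part fg computable_intros)
qed

lemma decidable_int_decode_less:
  "computable1 f \<Longrightarrow> computable1 g \<Longrightarrow> decidable (\<lambda>x. int_decode (f x) < int_decode (g x))"
proof -
  assume fg: "computable1 f" "computable1 g"
  have "int_decode m < int_decode n \<longleftrightarrow> pos_part m + neg_part n < pos_part n + neg_part m" for m n
    unfolding int_decode_parts by linarith
  then show ?thesis by (simp only:) (intro computable_pos_part computable_neg_part fg computable_intros)
qed

definition Z_pow_group :: "nat rel \<Rightarrow> nat monoid" where
  "Z_pow_group X = \<lparr>carrier = {c. dec c \<in> fin_supp X},
     mult = \<lambda>a b. enc (\<lambda>x. dec a x + dec b x), one = 0\<rparr>"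

definition Z_pow_code :: "nat rel \<Rightarrow> nat rel" where
  "Z_pow_code X = {(a, b). (dec a, dec b) \<in> Z_pow X}"

lemma dec_mult:
  "a \<in> carrier (Z_pow_group X) \<Longrightarrow> b \<in> carrier (Z_pow_group X) \<Longrightarrow>
    dec (a \<otimes>\<^bsub>Z_pow_group X\<^esub> b) = (\<lambda>x. dec a x + dec b x)"
  by (simp add: Z_pow_group_def dec_enc[OF fin_supp_add])

lemma group_Z_pow_group: "group (Z_pow_group X)"
proof (rule groupI)
  let ?G = "Z_pow_group X"
  have one: "dec \<one>\<^bsub>?G\<^esub> = (\<lambda>x. 0)" by (simp add: Z_pow_group_def dec_0)
  show one_closed: "\<one>\<^bsub>?G\<^esub> \<in> carrier ?G" by (simp add: Z_pow_group_def dec_0 fin_supp_zero)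
  show closed: "a \<otimes>\<^bsub>?G\<^esub> b \<in> carrier ?G" if "a \<in> carrier ?G" "b \<in> carrier ?G" for a b
    using that dec_mult[OF that] by (simp add: Z_pow_group_def fin_supp_add)
  show "a \<otimes>\<^bsub>?G\<^esub> b \<otimes>\<^bsub>?G\<^esub> c = a \<otimes>\<^bsub>?G\<^esub> (b \<otimes>\<^bsub>?G\<^esub> c)"
    if "a \<in> carrier ?G" "b \<in> carrier ?G" "c \<in> carrier ?G" for a b c
    using that by (intro dec_inject) (simp add: dec_mult closed add.assoc)
  show "\<one>\<^bsub>?G\<^esub> \<otimes>\<^bsub>?G\<^esub> a = a" if "a \<in> carrier ?G" for a
    using that one_closed by (intro dec_inject) (simp add: dec_mult one)
  show "\<exists>b\<in>carrier ?G. b \<otimes>\<^bsub>?G\<^esub> a = \<one>\<^bsub>?G\<^esub>" if a: "a \<in> carrier ?G" for a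
  proof
    have "(\<lambda>x. - dec a x) \<in> fin_supp X" using a by (simp add: Z_pow_group_def fin_supp_uminus)
    from dec_enc[OF this] this
    have b: "dec (enc (\<lambda>x. - dec a x)) = (\<lambda>x. - dec a x)" "enc (\<lambda>x. - dec a x) \<in> carrier ?G"
      by (simp_all add: Z_pow_group_def)
    then show "enc (\<lambda>x. - dec a x) \<otimes>\<^bsub>?G\<^esub> a = \<one>\<^bsub>?G\<^esub>"
      using a by (intro dec_inject) (simp add: dec_mult one)
    show "enc (\<lambda>x. - dec a x) \<in> carrier ?G" by (rule b)
  qed
qed

lemma ordered_group_Z_pow:
  assumes X: "Linear_order X"
  shows "ordered_group (Z_pow_group X) (Z_pow_code X)"
proof (intro ordered_group.intro ordered_group_axioms.intro group_Z_pow_group)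
  let ?G = "Z_pow_group X"
  note lin = Linear_order_Z_pow[OF X, unfolded order_on_defs]
  show "linear_order_on (carrier ?G) (Z_pow_code X)"
    unfolding order_on_defs
  proof (intro conjI)
    show "Z_pow_code X \<subseteq> carrier ?G \<times> carrier ?G" "refl_on (carrier ?G) (Z_pow_code X)"
      by (auto simp: refl_on_def Z_pow_code_def Z_pow_iff Z_pow_group_def)
    show "trans (Z_pow_code X)" using lin unfolding trans_def Z_pow_code_def by blast
    show "antisym (Z_pow_code X)"
      using lin unfolding antisym_def Z_pow_code_def by (auto intro: dec_inject)
    show "total_on (carrier ?G) (Z_pow_code X)"
      using lin unfolding total_on_def Z_pow_code_def Z_pow_group_def by (auto simp: dec_eq_iff)
  qed
  fix a b g assume ab: "(a, b) \<in> Z_pow_code X" and g: "g \<in> carrier ?G"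
  then have "a \<in> carrier ?G" "b \<in> carrier ?G" by (auto simp: Z_pow_code_def Z_pow_iff Z_pow_group_def)
  then show r: "(a \<otimes>\<^bsub>?G\<^esub> g, b \<otimes>\<^bsub>?G\<^esub> g) \<in> Z_pow_code X"
    and "(g \<otimes>\<^bsub>?G\<^esub> a, g \<otimes>\<^bsub>?G\<^esub> b) \<in> Z_pow_code X"
    using ab g Z_pow_add_right[of "dec a" "dec b" X "dec g"]
    by (simp_all add: Z_pow_code_def dec_mult add.commute) (simp_all add: Z_pow_group_def)
qed

lemma computable_ordered_group_Z_pow:
  assumes X: "Linear_order X" "computable_rel X"
  shows "computable_ordered_group (Z_pow_group X) (Z_pow_code X)"
  unfolding computable_ordered_group_def
proof (intro conjI)
  show "ordered_group (Z_pow_group X) (Z_pow_code X)" by (rule ordered_group_Z_pow[OF X(1)])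
  \<comment> \<open>Reflexivity makes the field of \<open>X\<close> decidable.\<close>
  have Field: "x \<in> Field X \<longleftrightarrow> (x, x) \<in> X" for x
    using X(1) unfolding order_on_defs refl_on_def Field_def by blast
  have carrier: "c \<in> carrier (Z_pow_group X) \<longleftrightarrow> (\<forall>i<c. digit c i \<noteq> 0 \<longrightarrow> (i, i) \<in> X)" for c
  proof -
    have "finite {i. digit c i \<noteq> 0}"
      using digit_less by (intro finite_subset[of "{i. digit c i \<noteq> 0}" "{..<c}"]) auto
    then show ?thesis
      using digit_less by (auto simp: Z_pow_group_def fin_supp_def dec_eq_0_iff Field subset_iff)
  qed
  have decidable_carrier: "decidable (\<lambda>c. c \<in> carrier (Z_pow_group X))"
    unfolding carrier by (intro decidable_rel[OF X(2)] computable_digit computable_intros)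
  then show "computable_set (carrier (Z_pow_group X))" by (rule computable_setI)
  \<comment> \<open>Positions where the digits differ lie below \<open>a + b\<close>, which bounds
    both quantifiers of the order on powers.\<close>
  have "(a, b) \<in> Z_pow_code X \<longleftrightarrow> a \<in> carrier (Z_pow_group X) \<and> b \<in> carrier (Z_pow_group X) \<and>
     (a = b \<or> (\<exists>x<a + b. (x, x) \<in> X \<and> int_decode (digit a x) < int_decode (digit b x) \<and>
       (\<forall>y<a + b. (y, y) \<in> X \<and> digit a y \<noteq> digit b y \<longrightarrow> (y, x) \<in> X)))" for a b
  proof -
    have *: "dec a y \<noteq> dec b y \<longleftrightarrow> digit a y \<noteq> digit b y" for y
      unfolding dec_def by (metis int_decode_inverse)
    have less: "digit a y \<noteq> digit b y \<Longrightarrow> y < a + b" for y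
      using digit_less[of a y] digit_less[of b y] by (cases "digit a y = 0") auto
    have "int_decode (digit a x) < int_decode (digit b x) \<Longrightarrow> x < a + b" for x
      using less by force
    then have "Z_less X (dec a) (dec b) \<longleftrightarrow> (\<exists>x<a + b. (x, x) \<in> X \<and>
        int_decode (digit a x) < int_decode (digit b x) \<and>
        (\<forall>y<a + b. (y, y) \<in> X \<and> digit a y \<noteq> digit b y \<longrightarrow> (y, x) \<in> X))"
      unfolding Z_less_def * Field[symmetric] using less by (auto simp: dec_def)
    then show ?thesis
      unfolding Z_pow_code_def Z_pow_iff dec_eq_iff by (simp add: Z_pow_group_def)
  qed
  then have "decidable (\<lambda>z. (pfst z, psnd z) \<in> Z_pow_code X)"
    by (simp only:)
      (intro decidable_comp[OF decidable_carrier] decidable_rel[OF X(2)] computable_digit decidable_int_decode_less computable_intros)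
  then show "computable_rel (Z_pow_code X)" by (rule computable_relI)
  \<comment> \<open>Beyond \<open>a + b + c\<close> all three codes have digit 0, so finitely many
    positions decide whether \<open>c\<close> codes the sum.\<close>
  define sum_eq where "sum_eq a b c \<longleftrightarrow>
    (\<forall>i<a + b + c. digit c i = add_code (digit a i) (digit b i))" for a b c
  have sum_eq: "sum_eq a b c \<longleftrightarrow> dec c = (\<lambda>x. dec a x + dec b x)" for a b c
  proof -
    have "digit c i = add_code (digit a i) (digit b i)" if "\<not> i < a + b + c" for i
      using that by (simp add: digit_eq_0 add_code_def int_decode_0 int_encode_0)
    then have "sum_eq a b c \<longleftrightarrow> (\<forall>i. digit c i = add_code (digit a i) (digit b i))"
      unfolding sum_eq_def by blast
    also have "\<dots> \<longleftrightarrow> (\<forall>i. dec c i = dec a i + dec b i)"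
      unfolding dec_def add_code_def by (metis int_decode_inverse int_encode_inverse)
    finally show ?thesis by auto
  qed
  have sum_ex: "sum_eq a b (enc (\<lambda>x. dec a x + dec b x))" for a b
  proof -
    \<comment> \<open>The search for a sum must end on all inputs, not only on the carrier; the
      equality relation has every number in its field, so every decoded function is finitely
      supported over it.\<close>
    have "dec c \<in> fin_supp {(x, y). x = y}" for c
      using digit_less finite_subset[of "{i. digit c i \<noteq> 0}" "{..<c}"]
      by (auto simp: fin_supp_def dec_eq_0_iff Field_def)
    then show ?thesis unfolding sum_eq by (intro dec_enc[of _ "{(x, y). x = y}"] fin_supp_add)
  qed
  \<comment> \<open>\<open>enc\<close> is given by choice; since codes are unique, searching for a
    code of the sum computes the same value.\<close>
  have "computable1 (\<lambda>z. LEAST c. (if sum_eq (pfst z) (psnd z) c then 0 else 1 :: nat) = 0)"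
    unfolding sum_eq_def
    by (intro computable_Least computable_digit computable_add_code computable_intros)
      (use sum_ex in \<open>force simp: sum_eq_def\<close>)
  moreover have "(LEAST c. (if sum_eq a b c then 0 else 1 :: nat) = 0) = enc (\<lambda>x. dec a x + dec b x)" for a b
  proof (rule Least_equality)
    fix y assume "(if sum_eq a b y then 0 else 1 :: nat) = 0"
    then have "dec y = (\<lambda>x. dec a x + dec b x)" using sum_eq by (auto split: if_splits)
    then show "enc (\<lambda>x. dec a x + dec b x) \<le> y" using enc_dec[of y] by simp
  qed (use sum_ex in simp)
  ultimately have "computable1 (\<lambda>z. enc (\<lambda>x. dec (pfst z) x + dec (psnd z) x))" by simp
  from computable2I[OF this] show "computable_binop_on (carrier (Z_pow_group X)) (\<lambda>x y. x \<otimes>\<^bsub>Z_pow_group X\<^esub> y)"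
    unfolding computable2_iff computable_binop_on_def Z_pow_group_def by auto
qed

section \<open>The order type of the group\<close>

lemma dense_unbounded_rat: "dense_unbounded_on (UNIV :: rat set) (<)"
  unfolding dense_unbounded_on_def strict_linear_on_def
  by (auto intro: dense lt_ex gt_ex)

lemma Field_rat_order: "Field rat_order = UNIV"
  by (auto simp: rat_order_def Field_def)

lemma countable_fin_supp: "countable (fin_supp (X :: nat rel))"
  by (rule countable_image_inj_on[of enc]) (auto intro!: inj_onI, metis dec_enc)

lemma same_order_type_Z_pow:
  assumes X: "Linear_order (X :: nat rel)" and not_wf: "\<not> wf (X - Id)"
  defines "A \<equiv> Wellfounded.acc (X - Id)"
  shows "same_order_type (Z_pow_code X) (order_prod (Z_pow (Restr X A)) rat_order)"
proof -
  let ?B = "Restr X (- A)"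
  have B: "Linear_order ?B" by (rule Linear_order_Restr[OF X])
  have FB: "Field ?B = Field X \<inter> - A" by (rule Field_Restr_Linear_order[OF X])
  \<comment> \<open>Read contrapositively: an element outside \<open>A\<close> has a smaller one
    outside \<open>A\<close>, so the complement has no least element.\<close>
  have acc: "x \<in> A" if "\<And>y. (y, x) \<in> X \<Longrightarrow> y \<noteq> x \<Longrightarrow> y \<in> A" for x
    unfolding A_def by (rule acc.intros) (use that in \<open>auto simp: A_def\<close>)
  have initial: "y \<in> A" if "(y, x) \<in> X" "x \<in> A" for x y
    using that acc_downward[of x "X - Id" y] unfolding A_def by (cases "y = x") auto
  have "dense_unbounded_on (fin_supp ?B) (Z_less ?B)"
  proof (rule dense_unbounded_Z_less[OF B])
    obtain x where x: "x \<notin> A" using not_wf unfolding wf_iff_acc A_def by blast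
    then obtain y where "(y, x) \<in> X" using acc by blast
    then have "x \<in> Field X" by (rule FieldI2)
    then show "Field ?B \<noteq> {}" using x unfolding FB by blast
    fix x assume "x \<in> Field ?B"
    then have "x \<notin> A" unfolding FB by blast
    then obtain y where "(y, x) \<in> X" "y \<noteq> x" "y \<notin> A" using acc by blast
    then show "\<exists>y. (y, x) \<in> ?B \<and> y \<noteq> x" using \<open>x \<notin> A\<close> by blast
  qed
  from cantor_dense_unbounded[OF this countable_fin_supp dense_unbounded_rat]
  obtain q :: "(nat \<Rightarrow> int) \<Rightarrow> rat" where q: "bij_betw q (fin_supp ?B) UNIV"
    "\<And>f g. f \<in> fin_supp ?B \<Longrightarrow> g \<in> fin_supp ?B \<Longrightarrow> Z_less ?B f g \<longleftrightarrow> q f < q g"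
    by auto
  \<comment> \<open>The accessible coordinates form the first component; the others, more
    significant, go to a rational in the second, which \<open>order_prod\<close> compares
    first.\<close>
  let ?\<phi> = "\<lambda>c. (restrict0 A (dec c), q (restrict0 (- A) (dec c)))"
  have Field_code: "Field (Z_pow_code X) = {c. dec c \<in> fin_supp X}"
    unfolding Field_def Z_pow_code_def Z_pow_iff by auto
  have "refl_on (fin_supp (Restr X A)) (Z_pow (Restr X A))"
    by (auto simp: refl_on_def Z_pow_iff)
  then have Field_prod: "Field (order_prod (Z_pow (Restr X A)) rat_order) = fin_supp (Restr X A) \<times> UNIV"
    by (simp add: Field_order_prod Field_Z_pow Field_rat_order)
  have "bij_betw dec {c. dec c \<in> fin_supp X} (fin_supp X)"
    by (rule bij_betw_byWitness[where f' = enc]) (auto simp: enc_dec dec_enc)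
  moreover have "bij_betw (\<lambda>(f, g). (f, q g)) (fin_supp (Restr X A) \<times> fin_supp ?B)
      (fin_supp (Restr X A) \<times> UNIV)"
    using bij_betw_map_prod[OF bij_betw_id q(1)] by (simp add: map_prod_def)
  ultimately have "bij_betw ?\<phi> (Field (Z_pow_code X)) (Field (order_prod (Z_pow (Restr X A)) rat_order))"
    using bij_betw_trans[OF bij_betw_trans[OF _ bij_betw_restrict0[OF X, of A]]]
    unfolding Field_code Field_prod comp_def by fastforce
  moreover have "(a, b) \<in> Z_pow_code X \<longleftrightarrow> (?\<phi> a, ?\<phi> b) \<in> order_prod (Z_pow (Restr X A)) rat_order"
    if "a \<in> Field (Z_pow_code X)" "b \<in> Field (Z_pow_code X)" for a b
  proof -
    let ?f = "dec a" and ?g = "dec b"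
    have fg: "?f \<in> fin_supp X" "?g \<in> fin_supp X" using that by (auto simp: Field_code)
    have r: "restrict0 A ?f \<in> fin_supp (Restr X A)" "restrict0 A ?g \<in> fin_supp (Restr X A)"
      "restrict0 (- A) ?f \<in> fin_supp ?B" "restrict0 (- A) ?g \<in> fin_supp ?B"
      using bij_betw_apply[OF bij_betw_restrict0[OF X] fg(1), of A]
        bij_betw_apply[OF bij_betw_restrict0[OF X] fg(2), of A] by auto
    have "q (restrict0 (- A) ?f) = q (restrict0 (- A) ?g) \<longleftrightarrow> restrict0 (- A) ?f = restrict0 (- A) ?g"
      using r q(1) by (auto simp: bij_betw_def inj_on_def)
    then show ?thesis
      using Z_pow_restrict0[OF X initial fg] q(2)[OF r(3,4)] r(1,2)
      by (auto simp: Z_pow_code_def order_prod_def Field_Z_pow Field_rat_order)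
        (auto simp: rat_order_def)
  qed
  ultimately show ?thesis unfolding same_order_type_def by blast
qed

theorem proposition2p8:
  shows "\<exists>(G :: nat monoid) (leq :: nat rel) (W :: nat rel).
    computable_ordered_group G leq \<and>
    is_omega1_CK W \<and>
    same_order_type leq (order_prod (Z_pow W) rat_order)"
  using computable_ordered_group_Z_pow[OF Linear_order_tree_order computable_rel_tree_order]
    is_omega1_CK_tree_wf_part same_order_type_Z_pow[OF Linear_order_tree_order]
    not_wf_tree_less
  unfolding tree_order_minus_Id tree_wf_part_def by blast

end
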